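(* Let $\Phi$, $\varphi$, $V$ be as in the standing assumption (see context), and suppose $\varphi\in\mathcal Z_{C_1}(\mathbb R^d)$ for some $C_1\in(0,1)$, with associated function $L_\varphi$. Suppose that there exist $\alpha\in(0,2)$ and a function $\ell$ slowly varying at zero such that $\Phi(u)\sim u^{\alpha/2}\ell(u)$ as $u\downarrow0$, and that there exist (1) $C_2,C_3,M_1>0$ and $\kappa\in\left(0,\frac{d+\alpha}2\right)$ such that $C_2|x|^{-2\kappa}\le\varphi(x)\le C_3|x|^{-2\kappa}$ for $x\in B^c_{M_1}(0)$, (2) $M_2,C_4>0$ such that $L_\varphi(x)\le C_4|x|^{-(2\kappa+2)}$ for $x\in B^c_{M_2}(0)$. Define $$p^*(\kappa,\alpha,d)=\begin{cases}\frac d{\alpha+d-2\kappa}&\kappa\in\left(\frac d2,\frac{d+\alpha}2\right),\\[1mm] \frac d\alpha&\kappa\in\left(0,\frac d2\right].\end{cases}$$ Then for every $p>p^*(\kappa,\alpha,d)$ there exists a constant $M>0$ such that $V\in L^p(B_M^c(0))$. Moreover, if $\varphi\in\mathcal Z_{C_1}(\mathbb R^d)\cap\mathcal Z_{\rm b,loc}(\mathbb R^d)$, then $V\in L^p(\mathbb R^d)$ for every $p>p^*(\kappa,\alpha,d)$ and $V\in L^\infty_{\rm loc}(\mathbb R^d)$.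
   Context: Notation: $B_r(a)$ is the open ball in $\mathbb R^d$, $B_r^c(a)$ its complement; $D_hf(x)=f(x+h)-2f(x)+f(x-h)$. $f\sim g$ means the ratio tends to $1$. A measurable $\ell:(0,\infty)\to(0,\infty)$ is slowly varying at zero if $\widetilde\ell(t)=\ell(1/t)$ satisfies $\lim_{t\to\infty}\widetilde\ell(ct)/\widetilde\ell(t)=1$ for every $c>0$. $\Phi$ is a complete Bernstein function with Lévy pair $(0,\mu)$: $\Phi(u)=\int_0^\infty(1-e^{-ut})\mu(t)\,dt$ with $\mu:(0,\infty)\to[0,\infty)$ completely monotone and $\int_0^\infty\min(1,t)\mu(t)\,dt<\infty$. The jump kernel is $j(r)=(4\pi)^{-d/2}\int_0^\infty t^{-d/2}e^{-r^2/(4t)}\mu(t)\,dt$, $r>0$. $\Phi(-\Delta)$ is the operator on $L^2(\mathbb R^d)$ with Fourier multiplier $\Phi(|y|^2)$. Standing assumption: $V:\mathbb R^d\to\mathbb R$ is a potential, $H=\Phi(-\Delta)+V$, and $\varphi\in L^2(\mathbb R^d)\cap L^\infty(\mathbb R^d)$, $\varphi>0$, satisfies $H\varphi=0$. The potential is understood through the pointwise expression $V(x)=-\frac{1}{\varphi(x)}\Phi(-\Delta)\varphi(x)=\frac{1}{2\varphi(x)}\int_{\mathbb R^d}D_h\varphi(x)\,j(|h|)\,dh$. Spaces: for $C\in(0,1)$, $\mathcal Z_C(\mathbb R^d)$ is the set of $f\in L^\infty(\mathbb R^d)$ for which there exist $M_f>0$ and $L_f\in L^\infty(B^c_{M_f}(0))$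 such that $|D_hf(x)|\le L_f(x)|h|^2$ for all $x\in B^c_{M_f}(0)$ and $h\in B_{C|x|}(0)$. For a set $K$, $\mathcal Z_{\rm b}(K)$ is the set of $f\in L^\infty(\mathbb R^d)$ for which there exist a constant $R>0$ and a bounded function $L:K\to(0,\infty)$ such that $|D_hf(x)|\le L(x)|h|^2$ for all $x\in K$, $h\in B_R(0)$; $f\in\mathcal Z_{\rm b,loc}(\mathbb R^d)$ means $f\in\mathcal Z_{\rm b}(K)$ for every compact $K\subset\mathbb R^d$. *)

theory Defs
  imports "HOL-Analysis.Analysis" "HOL-Library.Landau_Symbols"
begin

text \<open>
  The space \<open>\<real>\<^sup>d\<close> is a type \<open>'a :: euclidean_space\<close> with \<open>d = DIM('a)\<close>. Functions are genuine
  functions, not classes modulo null sets, because second differences and bounds are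
  imposed pointwise.
\<close>

section \<open>Function spaces\<close>

text \<open>All real \<open>p > 0\<close> are meant here; in dimension one, exponents below 1 do occur.\<close>

definition Lp_on :: "real \<Rightarrow> 'a::euclidean_space set \<Rightarrow> ('a \<Rightarrow> 'b::real_normed_vector) set" where
  "Lp_on p A = {f. f \<in> borel_measurable (lebesgue_on A) \<and>
                   integrable (lebesgue_on A) (\<lambda>x. norm (f x) powr p)}"

definition Linfty_on :: "'a::euclidean_space set \<Rightarrow> ('a \<Rightarrow> real) set" where
  "Linfty_on A = {f. f \<in> borel_measurable (lebesgue_on A) \<and>
                     (\<exists>B. AE x in lebesgue_on A. \<bar>f x\<bar> \<le> B)}"

definition Linfty_loc :: "('a::euclidean_space \<Rightarrow> real) set" where
  "Linfty_loc = {f. \<forall>K. compact K \<longrightarrow> f \<in> Linfty_on K}"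

definition second_diff :: "'a::euclidean_space \<Rightarrow> ('a \<Rightarrow> real) \<Rightarrow> 'a \<Rightarrow> real" where
  "second_diff h f x = f (x + h) - 2 * f x + f (x - h)"

text \<open>\<open>ZC_bound C f M L\<close>: the pair \<open>M\<close>, \<open>L\<close> plays the role of \<open>M\<^sub>f\<close>, \<open>L\<^sub>f\<close> for \<open>f\<close>.
  The complement \<open>- ball 0 M\<close> of the open ball is \<open>{x. norm x \<ge> M}\<close>.\<close>

definition ZC_bound ::
  "real \<Rightarrow> ('a::euclidean_space \<Rightarrow> real) \<Rightarrow> real \<Rightarrow> ('a \<Rightarrow> real) \<Rightarrow> bool" where
  "ZC_bound C f M L \<longleftrightarrow>
     M > 0 \<and> L \<in> Linfty_on (- ball 0 M) \<and>
     (\<forall>x \<in> - ball 0 M. \<forall>h \<in> ball 0 (C * norm x). \<bar>second_diff h f x\<bar> \<le> L x * (norm h)\<^sup>2)"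

definition ZC :: "real \<Rightarrow> ('a::euclidean_space \<Rightarrow> real) set" where
  "ZC C = {f. f \<in> Linfty_on UNIV \<and> (\<exists>M L. ZC_bound C f M L)}"

definition Zb :: "'a::euclidean_space set \<Rightarrow> ('a \<Rightarrow> real) set" where
  "Zb K = {f. f \<in> Linfty_on UNIV \<and>
     (\<exists>R>0. \<exists>L. (\<forall>x\<in>K. L x > 0) \<and> bounded (L ` K) \<and>
        (\<forall>x\<in>K. \<forall>h \<in> ball 0 R. \<bar>second_diff h f x\<bar> \<le> L x * (norm h)\<^sup>2))}"

definition Zb_loc :: "('a::euclidean_space \<Rightarrow> real) set" where
  "Zb_loc = {f. \<forall>K. compact K \<longrightarrow> f \<in> Zb K}"

section \<open>Slow variation and complete Bernstein functions\<close>

text \<open>Only the values of \<open>l\<close>, \<open>\<mu>\<close> on \<open>(0,\<infinity>)\<close> and of \<open>\<Phi>\<close> on \<open>[0,\<infinity>)\<close> are relevant.\<close>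

definition slowly_varying_at_zero :: "(real \<Rightarrow> real) \<Rightarrow> bool" where
  "slowly_varying_at_zero l \<longleftrightarrow>
     l \<in> borel_measurable (lebesgue_on {0<..}) \<and> (\<forall>t>0. l t > 0) \<and>
     (\<forall>c>0. ((\<lambda>t. l (1 / (c * t)) / l (1 / t)) \<longlongrightarrow> 1) at_top)"

definition completely_monotone :: "(real \<Rightarrow> real) \<Rightarrow> bool" where
  "completely_monotone \<mu> \<longleftrightarrow>
     (\<forall>n. \<forall>t>0. (deriv ^^ n) \<mu> differentiable (at t) \<and> (- 1) ^ n * (deriv ^^ n) \<mu> t \<ge> 0)"

text \<open>\<open>\<Phi>\<close> is a complete Bernstein function with Levy pair \<open>(0, \<mu>)\<close>.\<close>

definition complete_bernstein :: "(real \<Rightarrow> real) \<Rightarrow> (real \<Rightarrow> real) \<Rightarrow> bool" where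
  "complete_bernstein \<Phi> \<mu> \<longleftrightarrow>
     completely_monotone \<mu> \<and>
     set_integrable lborel {0<..} (\<lambda>t. min 1 t * \<mu> t) \<and>
     (\<forall>u\<ge>0. \<Phi> u = (LINT t:{0<..}|lborel. (1 - exp (- u * t)) * \<mu> t))"

definition jump_kernel :: "nat \<Rightarrow> (real \<Rightarrow> real) \<Rightarrow> real \<Rightarrow> real" where
  "jump_kernel d \<mu> r =
     (4 * pi) powr (- real d / 2) *
     (LINT t:{0<..}|lborel. t powr (- real d / 2) * exp (- r\<^sup>2 / (4 * t)) * \<mu> t)"

section \<open>The operator and the zero-energy equation\<close>

text \<open>
  \<open>F\<close> is the (unitary) Fourier transform of the square-integrable function \<open>f\<close>, that is,
  the \<open>L\<^sup>2\<close> limit of the Fourier integrals of \<open>f\<close> truncated to balls.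
\<close>

definition trunc_fourier ::
  "real \<Rightarrow> ('a::euclidean_space \<Rightarrow> complex) \<Rightarrow> 'a \<Rightarrow> complex" where
  "trunc_fourier R f y =
     complex_of_real ((2 * pi) powr (- real DIM('a) / 2)) *
     (LINT x:ball 0 R|lebesgue. cis (- (x \<bullet> y)) * f x)"

definition is_L2_fourier ::
  "('a::euclidean_space \<Rightarrow> complex) \<Rightarrow> ('a \<Rightarrow> complex) \<Rightarrow> bool" where
  "is_L2_fourier f F \<longleftrightarrow>
     f \<in> Lp_on 2 UNIV \<and> F \<in> Lp_on 2 UNIV \<and>
     ((\<lambda>R. \<integral>\<^sup>+ y. ennreal ((norm (F y - trunc_fourier R f y))\<^sup>2) \<partial>lebesgue) \<longlongrightarrow> 0) at_top"

text \<open>The graph of \<open>\<Phi>(-\<Delta>)\<close>: \<open>f\<close> belongs to its domain and \<open>g = \<Phi>(-\<Delta>) f\<close>.\<close>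

definition Phi_Laplacian ::
  "(real \<Rightarrow> real) \<Rightarrow> ('a::euclidean_space \<Rightarrow> complex) \<Rightarrow> ('a \<Rightarrow> complex) \<Rightarrow> bool" where
  "Phi_Laplacian \<Phi> f g \<longleftrightarrow>
     (\<exists>F G. is_L2_fourier f F \<and> is_L2_fourier g G \<and>
        (AE y in lebesgue. G y = complex_of_real (\<Phi> ((norm y)\<^sup>2)) * F y))"

text \<open>\<open>(\<Phi>(-\<Delta>) + V) \<phi> = 0\<close>.\<close>

definition zero_energy_eq ::
  "(real \<Rightarrow> real) \<Rightarrow> ('a::euclidean_space \<Rightarrow> real) \<Rightarrow> ('a \<Rightarrow> real) \<Rightarrow> bool" where
  "zero_energy_eq \<Phi> V \<phi> \<longleftrightarrow>
     (\<exists>g. Phi_Laplacian \<Phi> (\<lambda>x. complex_of_real (\<phi> x)) g \<and>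
        (AE x in lebesgue. g x + complex_of_real (V x * \<phi> x) = 0))"

text \<open>
  The pointwise expression of the potential. It is imposed exactly where the integral
  converges absolutely; elsewhere the Bochner integral would have the meaningless value 0.
\<close>

definition pointwise_potential ::
  "(real \<Rightarrow> real) \<Rightarrow> ('a::euclidean_space \<Rightarrow> real) \<Rightarrow> ('a \<Rightarrow> real) \<Rightarrow> bool" where
  "pointwise_potential \<mu> V \<phi> \<longleftrightarrow>
     (\<forall>x. integrable lebesgue (\<lambda>h. second_diff h \<phi> x * jump_kernel DIM('a) \<mu> (norm h)) \<longrightarrow>
        V x = 1 / (2 * \<phi> x) *
          (LINT h|lebesgue. second_diff h \<phi> x * jump_kernel DIM('a) \<mu> (norm h)))"

text \<open>For \<open>\<kappa> \<in> (0, (d + \<alpha>)/2)\<close>.\<close>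

definition p_star :: "real \<Rightarrow> real \<Rightarrow> nat \<Rightarrow> real" where
  "p_star \<kappa> \<alpha> d =
     (if \<kappa> > real d / 2 then real d / (\<alpha> + real d - 2 * \<kappa>) else real d / \<alpha>)"

end

theory Submission
  imports Defs
begin

text \<open>At a point \<open>x\<close>, split the second difference at the radius \<open>R = C\<^sub>1 |x|\<close>. Everything rests
  on two scale-invariant bounds for the jump kernel \<open>j\<close> (\<open>jump_kernel_bounds\<close>): the integral of
  \<open>min (R\<^sup>2) (|h|\<^sup>2) j(|h|)\<close> is at most a constant times \<open>R\<^sup>2 \<Phi>(1/R\<^sup>2)\<close>, and
  \<open>j(r) \<le> c R\<^sup>-\<^sup>d \<Phi>(1/R\<^sup>2)\<close> for \<open>r \<ge> R\<close>. The first holds because \<open>j\<close> is a mixture of heat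
  kernels with density \<open>\<mu>\<close>: a heat kernel at time \<open>t\<close> has truncated second moment of order
  \<open>min (R\<^sup>2) t\<close>, and \<open>min 1 s \<le> 2 (1 - exp (-s))\<close> turns the integral of this against \<open>\<mu>\<close> into
  \<open>\<Phi>(1/R\<^sup>2)\<close>. The second follows from the first, because the mixture is
  decreasing in \<open>r\<close>.

  For \<open>|h| < R\<close> the assumption on \<open>L\<^sub>\<phi>\<close> bounds the second difference by a
  constant times \<open>|x| powr (-2\<kappa>-2) |h|\<^sup>2\<close>.
  For \<open>|h| \<ge> R\<close> the values \<open>\<phi>(x \<plusminus> h)\<close> are at most of order \<open>|x| powr (-2\<kappa>)\<close> unless \<open>x \<plusminus> h\<close> lies in the
  ball of radius \<open>|x|\<close> about the origin; there the pointwise bound of \<open>j\<close> is paired with the mass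
  of \<open>\<phi>\<close> in that ball. After division by \<open>\<phi>(x)\<close>, which is comparable to \<open>|x| powr (-2\<kappa>)\<close>, this gives
  \<open>|V(x)| \<le> D \<Phi>(1/R\<^sup>2) (1 + |x| powr (2\<kappa>-d) m(|x|))\<close>, where \<open>m(r)\<close> is that mass. If \<open>2\<kappa> > d\<close> the mass
  stays bounded, otherwise it grows at most like \<open>r powr (d-2\<kappa>)\<close> up to an arbitrarily small power
  (\<open>mass_growth\<close>). Since \<open>\<Phi>(1/r\<^sup>2)\<close> decays like \<open>r powr (-\<alpha>)\<close> up to an arbitrarily small power
  (\<open>bernstein_decay\<close>), \<open>V\<close> decays at every rate below \<open>\<beta> = \<alpha> - max 0 (2\<kappa>-d)\<close>
  (\<open>potential_decay\<close>), and \<open>p*(\<kappa>,\<alpha>,d) = d/\<beta>\<close> is the integrability threshold for that rate.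

  On a compact set the same splitting with a fixed radius bounds \<open>V\<close> as soon as \<open>\<phi>\<close> is bounded away
  from zero there. This needs continuity of \<open>\<phi>\<close>, which a uniform second-difference bound supplies
  (\<open>Zb_imp_continuous_on\<close>): \<open>\<phi>\<close> is a uniform limit of its own averages.\<close>

section \<open>Affine changes of variables for Lebesgue measure\<close>

lemma lebesgue_affine_map:
  fixes t :: "'a::euclidean_space"
  assumes "c \<noteq> 0"
  shows lebesgue_measurable_affine_map: "(\<lambda>x. t + c *\<^sub>R x) \<in> lebesgue \<rightarrow>\<^sub>M lebesgue"
    and lebesgue_eq_affine_density:
      "lebesgue = density (distr lebesgue lebesgue (\<lambda>x. t + c *\<^sub>R x)) (\<lambda>_. \<bar>c\<bar> ^ DIM('a))"
  using lebesgue_affine_measurable[of "\<lambda>_::'a. c" t] lebesgue_affine_euclidean[of "\<lambda>_::'a. c" t] assms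
  unfolding scaleR_scaleR[symmetric] scaleR_sum_right[symmetric] euclidean_representation prod_constant
  by simp_all

lemma nn_integral_lebesgue_affine:
  fixes f :: "'a::euclidean_space \<Rightarrow> ennreal"
  assumes [measurable]: "f \<in> borel_measurable lebesgue" and c: "c \<noteq> 0"
  shows "(\<integral>\<^sup>+x. f x \<partial>lebesgue) = ennreal (\<bar>c\<bar> ^ DIM('a)) * (\<integral>\<^sup>+x. f (t + c *\<^sub>R x) \<partial>lebesgue)"
proof -
  note [measurable] = lebesgue_measurable_affine_map[OF c, of t]
  show ?thesis
    by (subst lebesgue_eq_affine_density[OF c, of t])
       (simp add: nn_integral_density nn_integral_distr nn_integral_cmult)
qed

lemma AE_lebesgue_affine:
  fixes t :: "'a::euclidean_space"
  assumes c: "c \<noteq> 0" and P: "AE x in lebesgue. P x"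
  shows "AE x in lebesgue. P (t + c *\<^sub>R x)"
proof -
  obtain N where N: "N \<in> null_sets lebesgue" "{x. \<not> P x} \<subseteq> N"
    using P by (auto simp: eventually_ae_filter)
  let ?N = "(\<lambda>x. t + c *\<^sub>R x) -` N"
  have m: "(\<lambda>x. t + c *\<^sub>R x) \<in> lebesgue \<rightarrow>\<^sub>M lebesgue" by (rule lebesgue_measurable_affine_map[OF c])
  have Ns: "N \<in> sets lebesgue" using N by blast
  have s: "?N \<in> sets lebesgue" using measurable_sets[OF m Ns] by simp
  have "0 = (\<integral>\<^sup>+x. indicator N x \<partial>lebesgue)" using N Ns by (simp add: null_sets_def del: emeasure_completion)
  also have "\<dots> = ennreal (\<bar>c\<bar> ^ DIM('a)) * (\<integral>\<^sup>+x. indicator N (t + c *\<^sub>R x) \<partial>lebesgue)"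
    using Ns c by (intro nn_integral_lebesgue_affine) auto
  also have "(\<integral>\<^sup>+x. indicator N (t + c *\<^sub>R x) \<partial>lebesgue) = (\<integral>\<^sup>+x. indicator ?N x \<partial>lebesgue)"
    by (simp add: indicator_def)
  also have "\<dots> = emeasure lebesgue ?N" using s by (rule nn_integral_indicator)
  finally have "emeasure lebesgue ?N = 0" using c by (simp del: emeasure_completion)
  with s have "?N \<in> null_sets lebesgue" by blast
  then show ?thesis by (rule AE_I') (use N in auto)
qed

lemma measurable_translates:
  fixes f :: "'a::euclidean_space \<Rightarrow> real"
  assumes f: "f \<in> borel_measurable lebesgue"
  shows "(\<lambda>h. f (x + h)) \<in> borel_measurable lebesgue"
    and "(\<lambda>h. f (x - h)) \<in> borel_measurable lebesgue"
  using measurable_compose[OF lebesgue_measurable_affine_map[of 1 x] f]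
    measurable_compose[OF lebesgue_measurable_affine_map[of "- 1" x] f] by simp_all

lemma nn_integral_translates:
  fixes f :: "'a::euclidean_space \<Rightarrow> real"
  assumes f: "f \<in> borel_measurable lebesgue"
  shows "(\<integral>\<^sup>+h. ennreal (f (x + h)) \<partial>lebesgue) = (\<integral>\<^sup>+h. ennreal (f h) \<partial>lebesgue)"
    and "(\<integral>\<^sup>+h. ennreal (f (x - h)) \<partial>lebesgue) = (\<integral>\<^sup>+h. ennreal (f h) \<partial>lebesgue)"
  using nn_integral_lebesgue_affine[of "\<lambda>x. ennreal (f x)" 1 x]
    nn_integral_lebesgue_affine[of "\<lambda>x. ennreal (f x)" "- 1" x] f by simp_all

lemma
  fixes f :: "'a::euclidean_space \<Rightarrow> real"
  assumes f: "f \<in> borel_measurable lebesgue"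
  shows integral_translates:
      "(LINT h|lebesgue. f (x + h)) = (LINT h|lebesgue. f h)"
      "(LINT h|lebesgue. f (x - h)) = (LINT h|lebesgue. f h)"
    and integrable_translates:
      "integrable lebesgue f \<Longrightarrow> integrable lebesgue (\<lambda>h. f (x + h))"
      "integrable lebesgue f \<Longrightarrow> integrable lebesgue (\<lambda>h. f (x - h))"
proof -
  have d: "distr lebesgue lebesgue (\<lambda>h. x + c *\<^sub>R h) = lebesgue" if "\<bar>c\<bar> = 1" for c :: real
    using lebesgue_eq_affine_density[of c x] that by (auto simp: density_1)
  have int: "(LINT h|lebesgue. f (x + c *\<^sub>R h)) = (LINT h|lebesgue. f h)"
    and integrable: "integrable lebesgue f \<Longrightarrow> integrable lebesgue (\<lambda>h. f (x + c *\<^sub>R h))"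
    if c: "\<bar>c\<bar> = 1" for c
  proof -
    have m: "(\<lambda>h. x + c *\<^sub>R h) \<in> lebesgue \<rightarrow>\<^sub>M lebesgue"
      using c by (intro lebesgue_measurable_affine_map) auto
    show "(LINT h|lebesgue. f (x + c *\<^sub>R h)) = (LINT h|lebesgue. f h)"
      using integral_distr[OF m f] d[OF c] by simp
    show "integrable lebesgue f \<Longrightarrow> integrable lebesgue (\<lambda>h. f (x + c *\<^sub>R h))"
      using integrable_distr[OF m, of f] d[OF c] by simp
  qed
  from int[of 1] int[of "- 1"] integrable[of 1] integrable[of "- 1"]
  show "(LINT h|lebesgue. f (x + h)) = (LINT h|lebesgue. f h)"
    and "(LINT h|lebesgue. f (x - h)) = (LINT h|lebesgue. f h)"
    and "integrable lebesgue f \<Longrightarrow> integrable lebesgue (\<lambda>h. f (x + h))"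
    and "integrable lebesgue f \<Longrightarrow> integrable lebesgue (\<lambda>h. f (x - h))" by simp_all
qed

section \<open>Polynomial weights and Gaussian moments\<close>

text \<open>
  Summing over dyadic balls avoids polar coordinates: on the shell \<open>2\<^sup>k \<le> 1 + |y| < 2\<^sup>k\<^sup>+\<^sup>1\<close> the
  weight is at most \<open>2 powr (-q k)\<close> while the volume is of order \<open>2\<^sup>k\<^sup>d\<close>, and the resulting
  geometric series converges exactly when \<open>q > d\<close>.
\<close>

lemma nn_integral_inverse_power_finite:
  assumes q: "q > real DIM('a::euclidean_space)"
  shows "(\<integral>\<^sup>+y. ennreal ((1 + norm (y::'a)) powr (- q)) \<partial>lborel) < \<infinity>"
proof -
  let ?d = "DIM('a)"
  let ?v = "unit_ball_vol (real ?d)"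
  have pw: "ennreal ((1 + norm y) powr (- q)) \<le>
      (\<Sum>k. ennreal (2 powr (- q * real k)) * indicator (ball 0 (2 ^ Suc k)) y)" for y :: 'a
  proof -
    define k where "k = nat \<lfloor>log 2 (1 + norm y)\<rfloor>"
    have pos: "1 + norm y > 0" by (simp add: add_pos_nonneg)
    have l0: "log 2 (1 + norm y) \<ge> 0" using pos by simp
    have k1: "real k \<le> log 2 (1 + norm y)" and k2: "log 2 (1 + norm y) < real (Suc k)"
      using l0 unfolding k_def by linarith+
    have "2 powr (real k) \<le> 1 + norm y" using k1 pos by (simp add: le_log_iff)
    then have "(1 + norm y) powr (- q) \<le> (2 powr real k) powr (- q)"
      using q by (intro powr_mono2') auto
    also have "\<dots> = 2 powr (- q * real k)" by (simp add: powr_powr mult.commute)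
    finally have 1: "(1 + norm y) powr (- q) \<le> 2 powr (- q * real k)" .
    have "1 + norm y < 2 powr (real (Suc k))" using k2 pos by (simp add: log_less_iff)
    also have "\<dots> = 2 ^ Suc k" by (rule powr_realpow) simp
    finally have "y \<in> ball 0 (2 ^ Suc k)" by simp
    then have "ennreal ((1 + norm y) powr (- q)) \<le>
        ennreal (2 powr (- q * real k)) * indicator (ball 0 (2 ^ Suc k)) y"
      using 1 by (auto intro: ennreal_leI)
    also have "\<dots> \<le> (\<Sum>k. ennreal (2 powr (- q * real k)) * indicator (ball 0 (2 ^ Suc k)) y)"
    proof -
      define g where "g = (\<lambda>j. ennreal (2 powr (- q * real j)) * indicator (ball 0 (2 ^ Suc j)) y)"
      have "sum g {k} \<le> suminf g" by (rule sum_le_suminf) auto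
      then show ?thesis by (subst (asm) sum.insert) (auto simp only: sum.empty add_0_right g_def)
    qed
    finally show ?thesis .
  qed
  define \<rho> where "\<rho> = 2 powr (real ?d - q)"
  have \<rho>: "0 \<le> \<rho>" "\<rho> < 1" using q powr_less_mono[of "real ?d - q" 0 2] by (auto simp: \<rho>_def)
  have level: "ennreal (2 powr (- q * real k)) * emeasure lborel (ball (0::'a) (2 ^ Suc k))
      = ennreal (?v * 2 ^ ?d * \<rho> ^ k)" for k
  proof -
    have "2 powr (- q * real k) * (2 ^ Suc k) ^ ?d = 2 ^ ?d * \<rho> ^ k"
    proof -
      have "(2 ^ Suc k) ^ ?d = (2::real) ^ ?d * 2 ^ (k * ?d)"
        by (simp add: power_mult_distrib power_mult)
      moreover have "(2::real) ^ (k * ?d) = 2 powr (real ?d * real k)"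
        by (subst powr_realpow[symmetric]) (auto simp: mult.commute)
      moreover have "\<rho> ^ k = 2 powr ((real ?d - q) * real k)"
        by (subst powr_realpow[symmetric]) (auto simp: \<rho>_def powr_powr)
      ultimately show ?thesis
        by (simp add: powr_add[symmetric] algebra_simps)
    qed
    then have eq: "2 powr (- q * real k) * (?v * (2 ^ Suc k) ^ ?d) = ?v * 2 ^ ?d * \<rho> ^ k"
      by (simp only: mult.assoc mult.left_commute[of _ ?v])
    have "emeasure lborel (ball (0::'a) (2 ^ Suc k)) = ennreal (?v * (2 ^ Suc k) ^ ?d)"
      by (rule emeasure_ball) simp
    then show ?thesis
      unfolding eq[symmetric] by (simp only: ennreal_mult' powr_ge_zero)
  qed
  have int: "(\<integral>\<^sup>+y. ennreal (2 powr (- q * real k)) * indicator (ball (0::'a) (2 ^ Suc k)) y \<partial>lborel)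
        = ennreal (?v * 2 ^ ?d * \<rho> ^ k)" for k
    by (rule trans[OF nn_integral_cmult_indicator level]) simp
  have "(\<integral>\<^sup>+y. ennreal ((1 + norm (y::'a)) powr (- q)) \<partial>lborel)
      \<le> (\<integral>\<^sup>+y. (\<Sum>k. ennreal (2 powr (- q * real k)) * indicator (ball 0 (2 ^ Suc k)) (y::'a)) \<partial>lborel)"
    by (intro nn_integral_mono pw)
  also have "\<dots> = (\<Sum>k. (\<integral>\<^sup>+y. ennreal (2 powr (- q * real k)) * indicator (ball (0::'a) (2 ^ Suc k)) y \<partial>lborel))"
  proof (rule nn_integral_suminf)
    show "(\<lambda>y. ennreal (2 powr (- q * real k)) * indicator (ball (0::'a) (2 ^ Suc k)) y) \<in> borel_measurable lborel" for k
      by (intro borel_measurable_times_ennreal borel_measurable_const borel_measurable_indicator) simp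
  qed
  also have "\<dots> = (\<Sum>k. ennreal (?v * 2 ^ ?d * \<rho> ^ k))"
    unfolding int ..
  also have "\<dots> < \<infinity>"
  proof -
    define w where "w = ?v * 2 ^ ?d"
    have w: "w \<ge> 0" unfolding w_def
      by (intro mult_nonneg_nonneg unit_ball_vol_nonneg zero_le_power of_nat_0_le_iff zero_le_numeral)
    have "summable (\<lambda>k. w * \<rho> ^ k)" using \<rho> by (intro summable_mult summable_geometric) simp
    then have "(\<Sum>k. ennreal (w * \<rho> ^ k)) = ennreal (\<Sum>k. w * \<rho> ^ k)"
      using \<rho> w by (intro suminf_ennreal2 mult_nonneg_nonneg zero_le_power)
    then show ?thesis unfolding w_def by (simp only: ennreal_less_top infinity_ennreal_def)
  qed
  finally show ?thesis .
qed

text \<open>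
  Completing the square gives \<open>s\<^sup>2/4 \<ge> s - 1\<close>, so the Gaussian is dominated by a simple
  exponential, which in turn beats every power.
\<close>

lemma gaussian_le_inverse_power:
  assumes "s \<ge> 0"
  shows "max 1 (s\<^sup>2) * exp (- (s\<^sup>2 / 4)) \<le> exp 2 * fact (n + 3) * (1 + s) powr (- real (n + 1))"
proof -
  have "0 \<le> (s / 2 - 1)\<^sup>2" by simp
  then have "- (s\<^sup>2 / 4) \<le> 2 - (1 + s)" by (simp add: power2_eq_square field_simps)
  then have e: "exp (- (s\<^sup>2 / 4)) \<le> exp 2 / exp (1 + s)" by (simp add: exp_diff[symmetric])
  define x where "x = 1 + s"
  have x: "x \<ge> 1" "s = x - 1" using assms by (auto simp: x_def)
  have "x ^ (n + 3) /\<^sub>R fact (n + 3) \<le> exp x"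
    using sum_le_suminf[OF summable_exp_generic[of x], of "{n + 3}"] x by (simp add: exp_def)
  then have "x ^ (n + 3) \<le> fact (n + 3) * exp x" by (simp add: field_simps)
  then have p: "x ^ 2 / exp x \<le> fact (n + 3) / x ^ (n + 1)"
    using x by (simp add: field_simps power_add power2_eq_square power3_eq_cube)
  have "max 1 (s\<^sup>2) \<le> x\<^sup>2" using x by (auto simp: power_mono)
  then have "max 1 (s\<^sup>2) * exp (- (s\<^sup>2 / 4)) \<le> x\<^sup>2 * (exp 2 / exp x)"
    using e by (intro mult_mono) (auto simp: x_def)
  also have "\<dots> = exp 2 * (x\<^sup>2 / exp x)" by simp
  also have "\<dots> \<le> exp 2 * (fact (n + 3) / x ^ (n + 1))" using p by (intro mult_left_mono) auto
  also have "\<dots> = exp 2 * fact (n + 3) * x powr (- real (n + 1))"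
    using x by (subst powr_minus, subst powr_realpow) (auto simp: field_simps)
  finally show ?thesis by (simp add: x_def)
qed


text \<open>
  The substitution \<open>h = sqrt t z\<close> removes the time from the Gaussian, and
  \<open>min (R\<^sup>2) (t |z|\<^sup>2) \<le> min (R\<^sup>2) t * max 1 (|z|\<^sup>2)\<close> separates the variables. What remains is
  a constant, the integral of \<open>max 1 (|z|\<^sup>2)\<close> against a fixed Gaussian.
\<close>

lemma truncated_gaussian_moment:
  obtains c where "c > 0"
    "\<And>t R. t > 0 \<Longrightarrow> R > 0 \<Longrightarrow>
       (\<integral>\<^sup>+h. ennreal (min (R\<^sup>2) ((norm (h::'a::euclidean_space))\<^sup>2) *
          (t powr (- real DIM('a) / 2) * exp (- (norm h)\<^sup>2 / (4 * t)))) \<partial>lborel)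
       \<le> ennreal (c * min (R\<^sup>2) t)"
proof -
  let ?d = "DIM('a)"
  let ?G = "\<lambda>z::'a. max 1 ((norm z)\<^sup>2) * exp (- ((norm z)\<^sup>2 / 4))"
  have "(\<integral>\<^sup>+z. ennreal (?G z) \<partial>lborel)
      \<le> (\<integral>\<^sup>+z. ennreal (exp 2 * fact (?d + 3)) * ennreal ((1 + norm (z::'a)) powr (- real (?d + 1))) \<partial>lborel)"
    using gaussian_le_inverse_power[of "norm _" ?d]
    by (intro nn_integral_mono) (simp add: ennreal_mult'[symmetric] ennreal_leI del: fact_Suc)
  also have "\<dots> = ennreal (exp 2 * fact (?d + 3)) * (\<integral>\<^sup>+z. ennreal ((1 + norm (z::'a)) powr (- real (?d + 1))) \<partial>lborel)"
    by (rule nn_integral_cmult) measurable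
  also have "\<dots> < \<infinity>"
    using nn_integral_inverse_power_finite[where 'a='a, of "real (?d + 1)"]
    by (simp add: ennreal_mult_less_top del: fact_Suc)
  finally have fin: "(\<integral>\<^sup>+z. ennreal (?G z) \<partial>lborel) < \<infinity>" .
  define c where "c = enn2real (\<integral>\<^sup>+z. ennreal (?G z) \<partial>lborel) + 1"
  have c: "c > 0" "(\<integral>\<^sup>+z. ennreal (?G z) \<partial>lborel) \<le> ennreal c"
    using fin by (auto simp: c_def add_nonneg_pos less_top ennreal_plus)
  show ?thesis
  proof (rule that[OF c(1)])
    fix t R :: real assume t: "t > 0" and R: "R > 0"
    let ?f = "\<lambda>h::'a. ennreal (min (R\<^sup>2) ((norm h)\<^sup>2) *
          (t powr (- real ?d / 2) * exp (- (norm h)\<^sup>2 / (4 * t))))"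
    have sc: "sqrt t ^ ?d * t powr (- real ?d / 2) = 1"
      using t by (simp add: powr_half_sqrt[symmetric] powr_realpow[symmetric] powr_powr powr_add[symmetric])
    have "(\<integral>\<^sup>+h. ?f h \<partial>lborel) = (\<integral>\<^sup>+h. ?f h \<partial>lebesgue)"
      by (simp add: nn_integral_completion)
    also have "\<dots> = ennreal (\<bar>sqrt t\<bar> ^ ?d) * (\<integral>\<^sup>+z. ?f (0 + sqrt t *\<^sub>R z) \<partial>lebesgue)"
    proof (rule nn_integral_lebesgue_affine)
      show "?f \<in> borel_measurable lebesgue" by (rule measurable_completion) measurable
    qed (use t in auto)
    also have "\<dots> = (\<integral>\<^sup>+z. ennreal (\<bar>sqrt t\<bar> ^ ?d) * ?f (0 + sqrt t *\<^sub>R z) \<partial>lborel)"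
      unfolding nn_integral_completion by (rule nn_integral_cmult[symmetric]) measurable
    also have "\<dots> \<le> (\<integral>\<^sup>+z. ennreal (min (R\<^sup>2) t) * ennreal (?G z) \<partial>lborel)"
    proof (rule nn_integral_mono)
      fix z :: 'a
      have n: "(norm (0 + sqrt t *\<^sub>R z))\<^sup>2 = t * (norm z)\<^sup>2"
        using t by (simp add: power_mult_distrib)
      have m: "min (R\<^sup>2) (t * (norm z)\<^sup>2) \<le> min (R\<^sup>2) t * max 1 ((norm z)\<^sup>2)"
      proof (cases "(norm z)\<^sup>2 \<le> 1")
        case True
        then show ?thesis using t by (auto simp: min_def mult_left_le intro: order_trans)
      next
        case False
        then have "R\<^sup>2 * 1 \<le> R\<^sup>2 * (norm z)\<^sup>2" by (intro mult_left_mono) auto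
        then show ?thesis using False by (auto simp: min_def)
      qed
      have "\<bar>sqrt t\<bar> ^ ?d * (min (R\<^sup>2) (t * (norm z)\<^sup>2) * (t powr (- real ?d / 2) * exp (- (t * (norm z)\<^sup>2) / (4 * t))))
         = (sqrt t ^ ?d * t powr (- real ?d / 2)) * (min (R\<^sup>2) (t * (norm z)\<^sup>2) * exp (- ((norm z)\<^sup>2 / 4)))"
        using t by simp
      also have "\<dots> \<le> (min (R\<^sup>2) t * max 1 ((norm z)\<^sup>2)) * exp (- ((norm z)\<^sup>2 / 4))"
        unfolding sc using m by (simp add: mult_right_mono)
      finally show "ennreal (\<bar>sqrt t\<bar> ^ ?d) * ?f (0 + sqrt t *\<^sub>R z) \<le> ennreal (min (R\<^sup>2) t) * ennreal (?G z)"
        unfolding n using t by (simp add: ennreal_mult'[symmetric] ennreal_leI mult.assoc)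
    qed
    also have "\<dots> = ennreal (min (R\<^sup>2) t) * (\<integral>\<^sup>+z. ennreal (?G z) \<partial>lborel)"
      by (rule nn_integral_cmult) measurable
    also have "\<dots> \<le> ennreal (min (R\<^sup>2) t) * ennreal c"
      by (intro mult_left_mono c) auto
    also have "\<dots> = ennreal (c * min (R\<^sup>2) t)"
      using t c by (simp add: ennreal_mult'[symmetric] mult.commute)
    finally show "(\<integral>\<^sup>+h. ?f h \<partial>lborel) \<le> ennreal (c * min (R\<^sup>2) t)" .
  qed
qed

section \<open>The jump kernel as a mixture of heat kernels\<close>

text \<open>
  For \<open>r > 0\<close> this is the jump kernel up to the factor \<open>(4 pi) powr (-d/2)\<close>, but as an extended nonnegative
  integral it is antitone and obeys Tonelli's theorem with no integrability to be checked first.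
\<close>

definition heat_mixture :: "(real \<Rightarrow> real) \<Rightarrow> nat \<Rightarrow> real \<Rightarrow> ennreal" where
  "heat_mixture \<mu> d r = (\<integral>\<^sup>+t. ennreal (t powr (- real d / 2) * exp (- r\<^sup>2 / (4 * t)) *
     (indicator {0<..} t * \<mu> t)) \<partial>lborel)"

context
  fixes \<Phi> \<mu> :: "real \<Rightarrow> real"
  assumes cb: "complete_bernstein \<Phi> \<mu>"
begin

lemma levy_density_nonneg: "t > 0 \<Longrightarrow> \<mu> t \<ge> 0"
  using cb unfolding complete_bernstein_def completely_monotone_def
  by (auto dest!: spec[of _ "0::nat"])

lemma levy_density_measurable [measurable]:
  "(\<lambda>t. indicator {0<..} t * \<mu> t) \<in> borel_measurable borel"
proof -
  have "\<mu> differentiable (at t)" if "t > 0" for t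
    using cb that unfolding complete_bernstein_def completely_monotone_def
    by (auto dest!: spec[of _ "0::nat"])
  then have "continuous_on {0<..} \<mu>"
    by (auto intro!: continuous_at_imp_continuous_on differentiable_imp_continuous_within)
  then show ?thesis
    using borel_measurable_continuous_on_indicator[of "{0<..}" \<mu>] by simp
qed

text \<open>
  The Levy condition makes the defining integral converge, because
  \<open>1 - exp (-u t) \<le> max 1 u * min 1 t\<close>; hence it agrees with the extended nonnegative integral.
\<close>

lemma bernstein_eq_nn_integral:
  assumes u: "u \<ge> 0"
  shows "ennreal (\<Phi> u) = (\<integral>\<^sup>+t. ennreal ((1 - exp (- u * t)) * (indicator {0<..} t * \<mu> t)) \<partial>lborel)"
    and "\<Phi> u \<ge> 0"
proof -
  let ?f = "\<lambda>t. (1 - exp (- u * t)) * (indicator {0<..} t * \<mu> t)"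
  have nn: "?f t \<ge> 0" for t
    using u levy_density_nonneg[of t] by (cases "t > 0") auto
  have \<Phi>: "\<Phi> u = (LINT t|lborel. ?f t)"
    using cb u unfolding complete_bernstein_def set_lebesgue_integral_def
    by (auto intro!: Bochner_Integration.integral_cong simp: indicator_def)
  have i: "integrable lborel (\<lambda>t. indicator {0<..} t * (min 1 t * \<mu> t))"
    using cb unfolding complete_bernstein_def set_integrable_def by simp
  have "integrable lborel ?f"
  proof (rule Bochner_Integration.integrable_bound[OF integrable_mult_right[OF i, of "max 1 u"]])
    show "AE t in lborel. norm (?f t) \<le> norm (max 1 u * (indicator {0<..} t * (min 1 t * \<mu> t)))"
    proof (rule AE_I2)
      fix t :: real
      show "norm (?f t) \<le> norm (max 1 u * (indicator {0<..} t * (min 1 t * \<mu> t)))"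
      proof (cases "t > 0")
        case True
        have "1 - exp (- u * t) \<le> max 1 u * min 1 t"
        proof (cases "t \<le> 1")
          case True
          have "1 - exp (- u * t) \<le> u * t" using exp_ge_add_one_self[of "- u * t"] by simp
          also have "\<dots> \<le> max 1 u * t" using \<open>t > 0\<close> by (intro mult_right_mono) auto
          finally show ?thesis using True by simp
        next
          case False
          have "1 - exp (- u * t) \<le> 1" by simp
          also have "\<dots> \<le> max 1 u * min 1 t" using False by simp
          finally show ?thesis .
        qed
        then have "?f t \<le> max 1 u * (indicator {0<..} t * (min 1 t * \<mu> t))"
          using True levy_density_nonneg[OF True] mult_right_mono by (fastforce simp: mult.assoc[symmetric])
        then show ?thesis using nn[of t] by (smt (verit) real_norm_def)
      qed simp
    qed
  qed measurable
  from nn_integral_eq_integral[OF this] nn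
  show "ennreal (\<Phi> u) = (\<integral>\<^sup>+t. ennreal (?f t) \<partial>lborel)" by (simp add: \<Phi>)
  show "\<Phi> u \<ge> 0" unfolding \<Phi> by (intro integral_nonneg_AE AE_I2 nn)
qed

lemma bernstein_mono:
  assumes "0 \<le> u" "u \<le> v"
  shows "\<Phi> u \<le> \<Phi> v"
proof -
  have "ennreal (\<Phi> u) \<le> ennreal (\<Phi> v)"
    unfolding bernstein_eq_nn_integral(1)[OF assms(1)]
      bernstein_eq_nn_integral(1)[OF order_trans[OF assms]]
  proof (intro nn_integral_mono ennreal_leI)
    fix t :: real
    show "(1 - exp (- u * t)) * (indicator {0<..} t * \<mu> t) \<le> (1 - exp (- v * t)) * (indicator {0<..} t * \<mu> t)"
      using assms levy_density_nonneg[of t] by (cases "t > 0") (auto intro!: mult_right_mono)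
  qed
  then show ?thesis using bernstein_eq_nn_integral(2) assms by (simp add: ennreal_le_iff)
qed

text \<open>
  With \<open>s = t/R\<^sup>2\<close> this is the integral of \<open>min 1 s \<le> 2 (1 - exp (-s))\<close> against \<open>\<mu>\<close>. It is the
  place where \<open>\<Phi>\<close> at the scale \<open>1/R\<^sup>2\<close> enters all later estimates.
\<close>

lemma truncated_levy_mass_le:
  assumes R: "R > 0"
  shows "(\<integral>\<^sup>+t. ennreal (min (R\<^sup>2) t * (indicator {0<..} t * \<mu> t)) \<partial>lborel) \<le> ennreal (2 * R\<^sup>2 * \<Phi> (1 / R\<^sup>2))"
proof -
  have "(\<integral>\<^sup>+t. ennreal (min (R\<^sup>2) t * (indicator {0<..} t * \<mu> t)) \<partial>lborel)
    \<le> (\<integral>\<^sup>+t. ennreal (2 * R\<^sup>2) * ennreal ((1 - exp (- (1 / R\<^sup>2) * t)) * (indicator {0<..} t * \<mu> t)) \<partial>lborel)"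
  proof (intro nn_integral_mono)
    fix t :: real
    have key: "min (R\<^sup>2) t \<le> 2 * R\<^sup>2 * (1 - exp (- (1 / R\<^sup>2) * t))" if "t > 0"
    proof -
      define s where "s = t / R\<^sup>2"
      have s: "s > 0" "t = R\<^sup>2 * s" using that R by (auto simp: s_def)
      have "exp (- s) \<le> 1 / (1 + s)"
        using exp_ge_add_one_self[of s] s by (simp add: exp_minus field_simps)
      then have "s / (1 + s) \<le> 1 - exp (- s)" using s by (simp add: field_simps)
      moreover have "min 1 s \<le> 2 * (s / (1 + s))" using s
        by (cases "s \<le> 1") (auto simp: min_def field_simps mult_left_le)
      ultimately have "min 1 s \<le> 2 * (1 - exp (- s))"
        by (meson mult_left_mono order_trans zero_le_numeral)
      then have "R\<^sup>2 * min 1 s \<le> R\<^sup>2 * (2 * (1 - exp (- s)))" by (intro mult_left_mono) auto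
      moreover have "R\<^sup>2 * min 1 s = min (R\<^sup>2) t" using R s
        by (auto simp: min_def mult_le_cancel_left1)
      ultimately show ?thesis using R s by (simp add: algebra_simps)
    qed
    show "ennreal (min (R\<^sup>2) t * (indicator {0<..} t * \<mu> t)) \<le>
       ennreal (2 * R\<^sup>2) * ennreal ((1 - exp (- (1 / R\<^sup>2) * t)) * (indicator {0<..} t * \<mu> t))"
    proof (cases "t > 0")
      case True
      have "min (R\<^sup>2) t * \<mu> t \<le> (2 * R\<^sup>2 * (1 - exp (- (1 / R\<^sup>2) * t))) * \<mu> t"
        using key[OF True] levy_density_nonneg[OF True] by (rule mult_right_mono)
      then show ?thesis using True
        by (simp add: ennreal_mult'[symmetric] ennreal_leI mult.assoc)
    qed simp
  qed
  also have "\<dots> = ennreal (2 * R\<^sup>2) * ennreal (\<Phi> (1 / R\<^sup>2))"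
    by (subst nn_integral_cmult) (auto simp: bernstein_eq_nn_integral(1) simp del: power2_eq_square)
  finally show ?thesis by (simp add: ennreal_mult')
qed

lemma heat_mixture_measurable [measurable]: "heat_mixture \<mu> d \<in> borel_measurable borel"
  unfolding heat_mixture_def by measurable

lemma heat_mixture_antimono:
  assumes "0 \<le> r" "r \<le> s"
  shows "heat_mixture \<mu> d s \<le> heat_mixture \<mu> d r"
  unfolding heat_mixture_def
proof (intro nn_integral_mono ennreal_leI)
  fix t :: real
  have "r\<^sup>2 \<le> s\<^sup>2" using assms by (intro power_mono)
  then show "t powr (- real d / 2) * exp (- s\<^sup>2 / (4 * t)) * (indicator {0<..} t * \<mu> t)
     \<le> t powr (- real d / 2) * exp (- r\<^sup>2 / (4 * t)) * (indicator {0<..} t * \<mu> t)"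
    using levy_density_nonneg[of t]
    by (cases "t > 0") (auto intro!: mult_right_mono mult_left_mono divide_right_mono)
qed

lemma jump_kernel_nonneg: "jump_kernel d \<mu> r \<ge> 0"
  unfolding jump_kernel_def set_lebesgue_integral_def
  by (intro mult_nonneg_nonneg integral_nonneg_AE AE_I2)
     (auto simp: indicator_def intro!: mult_nonneg_nonneg levy_density_nonneg)

text \<open>
  An inequality suffices, and it holds even where the Bochner integral does not converge: its value
  is then \<open>0\<close>.
\<close>

lemma jump_kernel_le_heat_mixture:
  "ennreal (jump_kernel d \<mu> r) \<le> ennreal ((4 * pi) powr (- real d / 2)) * heat_mixture \<mu> d r"
proof -
  let ?f = "\<lambda>t. indicator {0<..} t *\<^sub>R (t powr (- real d / 2) * exp (- r\<^sup>2 / (4 * t)) * \<mu> t)"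
  have nn: "?f t \<ge> 0" for t
    by (auto simp: indicator_def intro!: mult_nonneg_nonneg levy_density_nonneg)
  have "ennreal (LINT t|lborel. ?f t) \<le> (\<integral>\<^sup>+t. ennreal (?f t) \<partial>lborel)"
  proof (cases "integrable lborel ?f")
    case True
    then show ?thesis using nn_integral_eq_integral[OF True] nn by simp
  qed (simp add: not_integrable_integral_eq)
  also have "\<dots> = heat_mixture \<mu> d r"
    unfolding heat_mixture_def by (intro nn_integral_cong) (auto simp: indicator_def)
  finally show ?thesis
    unfolding jump_kernel_def set_lebesgue_integral_def
    by (simp add: ennreal_mult' mult_left_mono)
qed

lemma jump_kernel_measurable [measurable]: "jump_kernel d \<mu> \<in> borel_measurable borel"
proof -
  have "jump_kernel d \<mu> = (\<lambda>r. (4 * pi) powr (- real d / 2) *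
     (LINT t|lborel. t powr (- real d / 2) * exp (- r\<^sup>2 / (4 * t)) * (indicator {0<..} t * \<mu> t)))"
    unfolding jump_kernel_def set_lebesgue_integral_def
    by (intro ext arg_cong2[of _ _ _ _ "(*)"] Bochner_Integration.integral_cong) auto
  also have "\<dots> \<in> borel_measurable borel" by measurable
  finally show ?thesis .
qed

text \<open>
  Tonelli's theorem: the bound for a single heat kernel is integrated against \<open>\<mu>\<close>.
\<close>

lemma heat_mixture_moment_of_heat_kernel:
  assumes c: "c > 0"
    "\<And>t R. t > 0 \<Longrightarrow> R > 0 \<Longrightarrow>
       (\<integral>\<^sup>+h. ennreal (min (R\<^sup>2) ((norm (h::'a::euclidean_space))\<^sup>2) *
          (t powr (- real DIM('a) / 2) * exp (- (norm h)\<^sup>2 / (4 * t)))) \<partial>lborel)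
       \<le> ennreal (c * min (R\<^sup>2) t)"
    and R: "R > 0"
  shows "(\<integral>\<^sup>+h. ennreal (min (R\<^sup>2) ((norm (h::'a))\<^sup>2)) * heat_mixture \<mu> DIM('a) (norm h) \<partial>lborel)
     \<le> ennreal (2 * c * R\<^sup>2 * \<Phi> (1 / R\<^sup>2))"
proof -
  let ?g = "\<lambda>h t. t powr (- real DIM('a) / 2) * exp (- (norm (h::'a))\<^sup>2 / (4 * t))"
  let ?m = "\<lambda>t. indicator {0<..} t * \<mu> t"
  let ?M = "\<lambda>h. min (R\<^sup>2) ((norm (h::'a))\<^sup>2)"
  have m: "?m t \<ge> 0" for t using levy_density_nonneg[of t] by (cases "t > 0") auto
  have g: "?g h t \<ge> 0" for h t by simp
  have M: "?M h \<ge> 0" for h by simp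
  have "(\<integral>\<^sup>+h. ennreal (?M h) * heat_mixture \<mu> DIM('a) (norm h) \<partial>lborel)
      = (\<integral>\<^sup>+h. (\<integral>\<^sup>+t. ennreal (?M h) * ennreal (?g h t * ?m t) \<partial>lborel) \<partial>lborel)"
    unfolding heat_mixture_def
    by (intro nn_integral_cong nn_integral_cmult[symmetric]) measurable
  also have "\<dots> = (\<integral>\<^sup>+t. (\<integral>\<^sup>+h. ennreal (?M h) * ennreal (?g h t * ?m t) \<partial>lborel) \<partial>lborel)"
    by (rule lborel_pair.Fubini') measurable
  also have "\<dots> = (\<integral>\<^sup>+t. ennreal (?m t) * (\<integral>\<^sup>+h. ennreal (?M h * ?g h t) \<partial>lborel) \<partial>lborel)"
  proof (rule nn_integral_cong)
    fix t :: real
    have "(\<integral>\<^sup>+h. ennreal (?M h) * ennreal (?g h t * ?m t) \<partial>lborel)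
        = (\<integral>\<^sup>+h. ennreal (?m t) * ennreal (?M h * ?g h t) \<partial>lborel)"
    proof (rule nn_integral_cong)
      fix h :: 'a
      have "ennreal (?M h) * ennreal (?g h t * ?m t) = ennreal (?M h * (?g h t * ?m t))"
        by (rule ennreal_mult'[symmetric, OF M])
      also have "?M h * (?g h t * ?m t) = ?m t * (?M h * ?g h t)" by (simp only: mult_ac)
      also have "ennreal \<dots> = ennreal (?m t) * ennreal (?M h * ?g h t)"
        by (rule ennreal_mult'[OF m])
      finally show "ennreal (?M h) * ennreal (?g h t * ?m t) = ennreal (?m t) * ennreal (?M h * ?g h t)" .
    qed
    also have "\<dots> = ennreal (?m t) * (\<integral>\<^sup>+h. ennreal (?M h * ?g h t) \<partial>lborel)"
      by (rule nn_integral_cmult) measurable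
    finally show "(\<integral>\<^sup>+h. ennreal (?M h) * ennreal (?g h t * ?m t) \<partial>lborel)
        = ennreal (?m t) * (\<integral>\<^sup>+h. ennreal (?M h * ?g h t) \<partial>lborel)" .
  qed
  also have "\<dots> \<le> (\<integral>\<^sup>+t. ennreal c * ennreal (min (R\<^sup>2) t * ?m t) \<partial>lborel)"
  proof (rule nn_integral_mono)
    fix t :: real
    show "ennreal (?m t) * (\<integral>\<^sup>+h. ennreal (?M h * ?g h t) \<partial>lborel) \<le> ennreal c * ennreal (min (R\<^sup>2) t * ?m t)"
    proof (cases "t > 0")
      case True
      have "ennreal (?m t) * (\<integral>\<^sup>+h. ennreal (?M h * ?g h t) \<partial>lborel) \<le> ennreal (?m t) * ennreal (c * min (R\<^sup>2) t)"
        using c(2)[OF True R] by (rule mult_left_mono) simp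
      also have "\<dots> = ennreal (?m t * (c * min (R\<^sup>2) t))" by (rule ennreal_mult'[symmetric, OF m])
      also have "?m t * (c * min (R\<^sup>2) t) = c * (min (R\<^sup>2) t * ?m t)" by (simp only: mult_ac)
      also have "ennreal \<dots> = ennreal c * ennreal (min (R\<^sup>2) t * ?m t)"
        using c(1) by (intro ennreal_mult') simp
      finally show ?thesis .
    qed simp
  qed
  also have "\<dots> = ennreal c * (\<integral>\<^sup>+t. ennreal (min (R\<^sup>2) t * ?m t) \<partial>lborel)"
    by (rule nn_integral_cmult) measurable
  also have "\<dots> \<le> ennreal c * ennreal (2 * R\<^sup>2 * \<Phi> (1 / R\<^sup>2))"
    by (intro mult_left_mono truncated_levy_mass_le R) simp
  also have "\<dots> = ennreal (2 * c * R\<^sup>2 * \<Phi> (1 / R\<^sup>2))"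
    using c(1) by (simp add: ennreal_mult'[symmetric] mult_ac)
  finally show ?thesis .
qed

lemma heat_mixture_truncated_moment:
  obtains c where "c > 0"
    "\<And>R. R > 0 \<Longrightarrow>
       (\<integral>\<^sup>+h. ennreal (min (R\<^sup>2) ((norm (h::'a::euclidean_space))\<^sup>2)) * heat_mixture \<mu> DIM('a) (norm h) \<partial>lborel)
       \<le> ennreal (c * R\<^sup>2 * \<Phi> (1 / R\<^sup>2))"
proof -
  obtain c where "c > 0" "\<And>t R. t > 0 \<Longrightarrow> R > 0 \<Longrightarrow>
       (\<integral>\<^sup>+h. ennreal (min (R\<^sup>2) ((norm (h::'a::euclidean_space))\<^sup>2) *
          (t powr (- real DIM('a) / 2) * exp (- (norm h)\<^sup>2 / (4 * t)))) \<partial>lborel)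
       \<le> ennreal (c * min (R\<^sup>2) t)"
    using truncated_gaussian_moment by blast
  from heat_mixture_moment_of_heat_kernel[OF this] that[of "2 * c"] \<open>c > 0\<close> show ?thesis by simp
qed

end

text \<open>
  The pointwise bound comes from the moment bound: the mixture is antitone in the radius, so its value
  at \<open>R\<close> times the integral of \<open>|h|\<^sup>2\<close> over a ball of radius \<open>R/4\<close> inside the annulus
  \<open>R/4 \<le> |h| \<le> R\<close> cannot exceed the truncated moment.
\<close>

lemma jump_kernel_bounds:
  assumes cb: "complete_bernstein \<Phi> \<mu>"
  obtains c where "c > 0"
    "\<And>R. R > 0 \<Longrightarrow>
       (\<integral>\<^sup>+h. ennreal (min (R\<^sup>2) ((norm (h::'a::euclidean_space))\<^sup>2) * jump_kernel DIM('a) \<mu> (norm h)) \<partial>lborel)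
       \<le> ennreal (c * R\<^sup>2 * \<Phi> (1 / R\<^sup>2))"
    "\<And>R r. R > 0 \<Longrightarrow> R \<le> r \<Longrightarrow> jump_kernel DIM('a) \<mu> r \<le> c * \<Phi> (1 / R\<^sup>2) / R ^ DIM('a)"
proof -
  let ?d = "DIM('a)"
  let ?J = "heat_mixture \<mu> ?d" and ?j = "jump_kernel ?d \<mu>"
  define K where "K = (4 * pi) powr (- real ?d / 2)"
  define v where "v = unit_ball_vol (real ?d)"
  have K: "K > 0" by (simp add: K_def)
  have v: "v > 0" by (simp add: v_def)
  obtain c where c: "c > 0" and moment: "\<And>R. R > 0 \<Longrightarrow>
       (\<integral>\<^sup>+h. ennreal (min (R\<^sup>2) ((norm (h::'a))\<^sup>2)) * ?J (norm h) \<partial>lborel) \<le> ennreal (c * R\<^sup>2 * \<Phi> (1 / R\<^sup>2))"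
    using heat_mixture_truncated_moment[OF cb, where 'a = 'a] by blast
  have jJ: "ennreal (?j r) \<le> ennreal K * ?J r" for r
    unfolding K_def by (rule jump_kernel_le_heat_mixture[OF cb])
  have \<Phi>0: "\<Phi> (1 / R\<^sup>2) \<ge> 0" for R by (intro bernstein_eq_nn_integral(2)[OF cb]) simp
  have J_bound: "?J R \<le> ennreal (16 * 4 ^ ?d * c / v * \<Phi> (1 / R\<^sup>2) / R ^ ?d)" if R: "R > 0" for R
  proof -
    obtain b :: 'a where b: "norm b = 1" using norm_Basis nonempty_Basis by blast
    \<comment> \<open>This ball lies in the annulus between the radii \<open>R / 4\<close> and \<open>R\<close>.\<close>
    let ?S = "ball ((R / 2) *\<^sub>R b) (R / 4)"
    have S: "R / 4 \<le> norm h" "norm h \<le> R" if "h \<in> ?S" for h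
    proof -
      have "norm ((R / 2) *\<^sub>R b - h) < R / 4" using that by (simp add: dist_norm)
      moreover have "norm ((R / 2) *\<^sub>R b) = R / 2" using b R by simp
      ultimately show "R / 4 \<le> norm h" "norm h \<le> R"
        using norm_triangle_ineq2[of "(R / 2) *\<^sub>R b" h] norm_triangle_ineq3[of "(R / 2) *\<^sub>R b" h] by linarith+
    qed
    have "ennreal ((R / 4)\<^sup>2 * (v * (R / 4) ^ ?d)) * ?J R = ennreal ((R / 4)\<^sup>2) * ?J R * emeasure lborel ?S"
    proof -
      have "emeasure lborel ?S = ennreal (v * (R / 4) ^ ?d)"
        unfolding v_def using R by (intro emeasure_ball) simp
      moreover have "ennreal ((R / 4)\<^sup>2 * (v * (R / 4) ^ ?d)) = ennreal ((R / 4)\<^sup>2) * ennreal (v * (R / 4) ^ ?d)"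
        by (rule ennreal_mult') simp
      ultimately show ?thesis by (simp only: mult_ac)
    qed
    also have "\<dots> = (\<integral>\<^sup>+h. ennreal ((R / 4)\<^sup>2) * ?J R * indicator ?S h \<partial>lborel)"
      by (rule nn_integral_cmult_indicator[symmetric]) simp
    also have "\<dots> \<le> (\<integral>\<^sup>+h. ennreal (min (R\<^sup>2) ((norm (h::'a))\<^sup>2)) * ?J (norm h) \<partial>lborel)"
    proof (rule nn_integral_mono)
      fix h :: 'a
      show "ennreal ((R / 4)\<^sup>2) * ?J R * indicator ?S h \<le> ennreal (min (R\<^sup>2) ((norm h)\<^sup>2)) * ?J (norm h)"
      proof (cases "h \<in> ?S")
        case True
        have "(R / 4)\<^sup>2 \<le> (norm h)\<^sup>2" "(R / 4)\<^sup>2 \<le> R\<^sup>2" using S(1)[OF True] R by (auto intro!: power_mono)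
        then have "(R / 4)\<^sup>2 \<le> min (R\<^sup>2) ((norm h)\<^sup>2)" by simp
        then show ?thesis using True S(2)[OF True] 
          by (auto intro!: mult_mono ennreal_leI heat_mixture_antimono[OF cb])
      qed simp
    qed
    also have "\<dots> \<le> ennreal (c * R\<^sup>2 * \<Phi> (1 / R\<^sup>2))" by (rule moment[OF R])
    finally have *: "ennreal ((R / 4)\<^sup>2 * (v * (R / 4) ^ ?d)) * ?J R \<le> ennreal (c * R\<^sup>2 * \<Phi> (1 / R\<^sup>2))" .
    define A where "A = (R / 4)\<^sup>2 * (v * (R / 4) ^ ?d)"
    have A: "A > 0" using R v by (simp add: A_def)
    have "?J R = ennreal (1 / A) * (ennreal A * ?J R)"
      using A by (simp add: mult.assoc[symmetric] ennreal_mult'[symmetric])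
    also have "\<dots> \<le> ennreal (1 / A) * ennreal (c * R\<^sup>2 * \<Phi> (1 / R\<^sup>2))"
      using * unfolding A_def by (rule mult_left_mono) simp
    also have "\<dots> = ennreal (1 / A * (c * R\<^sup>2 * \<Phi> (1 / R\<^sup>2)))"
      using A by (intro ennreal_mult'[symmetric]) simp
    also have "1 / A * (c * R\<^sup>2 * \<Phi> (1 / R\<^sup>2)) = 16 * 4 ^ ?d * c / v * \<Phi> (1 / R\<^sup>2) / R ^ ?d"
      using R v by (simp add: A_def field_simps power_divide)
    finally show ?thesis .
  qed
  define c' where "c' = K * c + K * (16 * 4 ^ ?d * c / v)"
  have c': "c' > 0" "K * c \<le> c'" "K * (16 * 4 ^ ?d * c / v) \<le> c'" using K c v by (auto simp: c'_def intro!: add_pos_pos)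
  show ?thesis
  proof (rule that[OF c'(1)])
    fix R :: real assume R: "R > 0"
    have "(\<integral>\<^sup>+h. ennreal (min (R\<^sup>2) ((norm (h::'a))\<^sup>2) * ?j (norm h)) \<partial>lborel)
        \<le> (\<integral>\<^sup>+h. ennreal K * (ennreal (min (R\<^sup>2) ((norm (h::'a))\<^sup>2)) * ?J (norm h)) \<partial>lborel)"
    proof (rule nn_integral_mono)
      fix h :: 'a
      have "ennreal (min (R\<^sup>2) ((norm h)\<^sup>2) * ?j (norm h)) = ennreal (min (R\<^sup>2) ((norm h)\<^sup>2)) * ennreal (?j (norm h))"
        by (rule ennreal_mult') simp
      also have "\<dots> \<le> ennreal (min (R\<^sup>2) ((norm h)\<^sup>2)) * (ennreal K * ?J (norm h))"
        by (intro mult_left_mono jJ) simp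
      finally show "ennreal (min (R\<^sup>2) ((norm h)\<^sup>2) * ?j (norm h)) \<le> ennreal K * (ennreal (min (R\<^sup>2) ((norm h)\<^sup>2)) * ?J (norm h))"
        by (simp only: mult_ac)
    qed
    also have "\<dots> = ennreal K * (\<integral>\<^sup>+h. ennreal (min (R\<^sup>2) ((norm (h::'a))\<^sup>2)) * ?J (norm h) \<partial>lborel)"
      by (rule nn_integral_cmult) (use heat_mixture_measurable[OF cb] in measurable)
    also have "\<dots> \<le> ennreal K * ennreal (c * R\<^sup>2 * \<Phi> (1 / R\<^sup>2))"
      by (intro mult_left_mono moment R) simp
    also have "\<dots> = ennreal (K * c * (R\<^sup>2 * \<Phi> (1 / R\<^sup>2)))"
      using K by (simp add: ennreal_mult'[symmetric] mult.assoc)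
    also have "\<dots> \<le> ennreal (c' * (R\<^sup>2 * \<Phi> (1 / R\<^sup>2)))"
      using c'(2) \<Phi>0 by (intro ennreal_leI mult_right_mono) auto
    finally show "(\<integral>\<^sup>+h. ennreal (min (R\<^sup>2) ((norm (h::'a))\<^sup>2) * ?j (norm h)) \<partial>lborel) \<le> ennreal (c' * R\<^sup>2 * \<Phi> (1 / R\<^sup>2))"
      by (simp only: mult.assoc)
  next
    fix R r :: real assume R: "R > 0" "R \<le> r"
    have "ennreal (?j r) \<le> ennreal K * ?J R"
      using jJ[of r] heat_mixture_antimono[OF cb, of R r] R
      by (meson less_imp_le mult_left_mono order_trans zero_le)
    also have "\<dots> \<le> ennreal K * ennreal (16 * 4 ^ ?d * c / v * \<Phi> (1 / R\<^sup>2) / R ^ ?d)"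
      by (intro mult_left_mono J_bound R) simp
    also have "\<dots> = ennreal (K * (16 * 4 ^ ?d * c / v) * (\<Phi> (1 / R\<^sup>2) / R ^ ?d))"
      using K by (subst ennreal_mult'[symmetric]) (simp_all add: mult.assoc)
    finally have "?j r \<le> K * (16 * 4 ^ ?d * c / v) * (\<Phi> (1 / R\<^sup>2) / R ^ ?d)"
      using K c v R \<Phi>0[of R] by (subst (asm) ennreal_le_iff) (auto intro!: mult_nonneg_nonneg)
    also have "\<dots> \<le> c' * (\<Phi> (1 / R\<^sup>2) / R ^ ?d)"
      using c'(3) R \<Phi>0[of R] by (intro mult_right_mono) auto
    finally show "?j r \<le> c' * \<Phi> (1 / R\<^sup>2) / R ^ ?d" by simp
  qed
qed

section \<open>Decay of the Bernstein function at zero\<close>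

text \<open>
  A gain of the factor \<open>2 powr (-a)\<close> at each doubling, filled in between by monotonicity, is power
  decay of order \<open>a\<close>.
\<close>

lemma power_bound_of_doubling:
  fixes g :: "real \<Rightarrow> real"
  assumes t0: "t0 > 0" and a: "a \<ge> 0"
    and anti: "\<And>s t. t0 \<le> s \<Longrightarrow> s \<le> t \<Longrightarrow> g t \<le> g s"
    and double: "\<And>t. t0 \<le> t \<Longrightarrow> g (2 * t) \<le> 2 powr (- a) * g t"
    and nonneg: "g t0 \<ge> 0"
    and t: "t0 \<le> t"
  shows "g t \<le> g t0 * (2 * t0) powr a * t powr (- a)"
proof -
  have iter: "g (2 ^ n * t0) \<le> (2 ^ n) powr (- a) * g t0" for n
  proof (induction n)
    case (Suc n)
    have "g (2 * (2 ^ n * t0)) \<le> 2 powr (- a) * g (2 ^ n * t0)"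
      using t0 by (intro double) simp
    also have "\<dots> \<le> 2 powr (- a) * ((2 ^ n) powr (- a) * g t0)"
      using Suc by (intro mult_left_mono) auto
    also have "\<dots> = (2 ^ Suc n) powr (- a) * g t0"
      by (simp add: powr_mult)
    finally show ?case by (simp add: mult.assoc)
  qed simp
  define n where "n = nat \<lfloor>log 2 (t / t0)\<rfloor>"
  have q: "t / t0 \<ge> 1" using t t0 by simp
  then have l0: "log 2 (t / t0) \<ge> 0" by simp
  have n1: "real n \<le> log 2 (t / t0)" and n2: "log 2 (t / t0) < real (Suc n)"
    using l0 unfolding n_def by linarith+
  have "2 powr real n \<le> t / t0" using n1 q by (simp add: le_log_iff)
  then have lo: "2 ^ n * t0 \<le> t" using t0 by (simp add: powr_realpow field_simps)
  have "t / t0 < 2 powr real (Suc n)" using n2 q by (simp add: log_less_iff del: of_nat_Suc)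
  also have "\<dots> = 2 ^ Suc n" by (rule powr_realpow) simp
  finally have hi: "t / (2 * t0) \<le> 2 ^ n" using t0 by (simp add: field_simps)
  have "g t \<le> g (2 ^ n * t0)" using lo t0 by (intro anti) auto
  also have "\<dots> \<le> (2 ^ n) powr (- a) * g t0" by (rule iter)
  also have "\<dots> \<le> (t / (2 * t0)) powr (- a) * g t0"
    using a hi nonneg t t0 by (intro mult_right_mono powr_mono2') auto
  also have "\<dots> = g t0 * (2 * t0) powr a * t powr (- a)"
    using t t0 by (simp add: powr_divide powr_minus field_simps)
  finally show ?thesis .
qed

text \<open>
  Slow variation at the ratio \<open>2\<close> makes \<open>\<Phi>(1/(2t)) / \<Phi>(1/t)\<close> converge to \<open>2 powr (-b)\<close>,
  which is strictly below \<open>2 powr (-a)\<close>.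
\<close>

lemma regular_variation_doubling:
  assumes l: "slowly_varying_at_zero l"
    and asymp: "\<Phi> \<sim>[at_right 0] (\<lambda>u. u powr b * l u)"
    and a: "a < b"
  shows "eventually (\<lambda>t. \<Phi> (1 / (2 * t)) \<le> 2 powr (- a) * \<Phi> (1 / t)) at_top"
proof -
  define k where "k t = (1 / t) powr b * l (1 / t)" for t
  define G where "G t = \<Phi> (1 / t)" for t
  have lpos: "l t > 0" if "t > 0" for t using l that by (simp add: slowly_varying_at_zero_def)
  have kpos: "k t > 0" if "t > 0" for t using lpos[of "1 / t"] that by (simp add: k_def)
  have ev: "eventually (\<lambda>u. \<Phi> u \<noteq> 0 \<or> u powr b * l u \<noteq> 0) (at_right 0)"
    using eventually_at_right_less[of 0] by eventually_elim (use lpos in force)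
  have "((\<lambda>u. \<Phi> u / (u powr b * l u)) \<longlongrightarrow> 1) (at_right 0)"
    by (rule asymp_equivD_strong[OF asymp ev])
  then have lim: "((\<lambda>t. G t / k t) \<longlongrightarrow> 1) at_top"
    unfolding filterlim_at_right_to_top G_def k_def by (simp add: inverse_eq_divide)
  have "filterlim (\<lambda>t::real. 2 * t) at_top at_top"
    by (rule filterlim_tendsto_pos_mult_at_top[OF tendsto_const _ filterlim_ident]) simp
  then have lim2: "((\<lambda>t. G (2 * t) / k (2 * t)) \<longlongrightarrow> 1) at_top"
    by (rule filterlim_compose[OF lim])
  have "((\<lambda>t. l (1 / (2 * t)) / l (1 / t)) \<longlongrightarrow> 1) at_top"
    using l by (simp add: slowly_varying_at_zero_def)
  then have lim3: "((\<lambda>t. (G (2 * t) / k (2 * t)) / (G t / k t) * (2 powr (- b) * (l (1 / (2 * t)) / l (1 / t)))) \<longlongrightarrow> (1 / 1) * (2 powr (- b) * 1)) at_top"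
    by (intro tendsto_intros lim lim2) auto
  have "eventually (\<lambda>t. G t / k t > 0) at_top"
    using lim by (rule order_tendstoD) simp
  then have ev2: "eventually (\<lambda>t. G t > 0 \<and> (G (2 * t) / k (2 * t)) / (G t / k t) * (2 powr (- b) * (l (1 / (2 * t)) / l (1 / t))) = G (2 * t) / G t) at_top"
    using eventually_gt_at_top[of 0]
  proof eventually_elim
    case (elim t)
    have G: "G t > 0" using elim kpos[of t] by (simp add: zero_less_divide_iff)
    define w where "w = 2 powr (- b) * (l (1 / (2 * t)) / l (1 / t))"
    have "w > 0" using elim lpos by (simp add: w_def)
    moreover have "k (2 * t) = w * k t"
      using elim lpos[of "1 / t"]
      by (simp add: k_def w_def powr_divide powr_mult powr_minus field_simps)
    moreover have "k t > 0" using elim kpos by simp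
    ultimately have "(G (2 * t) / k (2 * t)) / (G t / k t) * w = G (2 * t) / G t"
      using G by (simp add: field_simps)
    then show ?case using G unfolding w_def by simp
  qed
  have "((\<lambda>t. G (2 * t) / G t) \<longlongrightarrow> (1 / 1) * (2 powr (- b) * 1)) at_top"
    by (rule Lim_transform_eventually[OF lim3 eventually_mono[OF ev2]]) simp
  moreover have "(1 / 1) * (2 powr (- b) * 1) < (2::real) powr (- a)" using a by simp
  ultimately have "eventually (\<lambda>t. G (2 * t) / G t < 2 powr (- a)) at_top"
    by (rule order_tendstoD(2))
  moreover have "eventually (\<lambda>t. G t > 0) at_top" by (rule eventually_mono[OF ev2]) simp
  ultimately show ?thesis
    by eventually_elim (simp add: G_def field_simps)
qed

text \<open>
  Monotonicity of \<open>\<Phi>\<close> takes the place of Potter's bounds: combined with the doubling estimate it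
  yields every nonnegative exponent below the index of regular variation.
\<close>

lemma bernstein_decay:
  assumes cb: "complete_bernstein \<Phi> \<mu>"
    and l: "slowly_varying_at_zero l"
    and asymp: "\<Phi> \<sim>[at_right 0] (\<lambda>u. u powr b * l u)"
    and a: "0 \<le> a" "a < b"
  obtains C t0 where "C > 0" "t0 > 0" "\<And>t. t0 \<le> t \<Longrightarrow> \<Phi> (1 / t) \<le> C * t powr (- a)"
proof -
  obtain t1 where t1: "\<And>t. t1 \<le> t \<Longrightarrow> \<Phi> (1 / (2 * t)) \<le> 2 powr (- a) * \<Phi> (1 / t)"
    using regular_variation_doubling[OF l asymp a(2)] by (auto simp: eventually_at_top_linorder)
  define t0 where "t0 = max t1 1"
  define C where "C = \<Phi> (1 / t0) * (2 * t0) powr a + 1"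
  have t0: "t0 > 0" "t1 \<le> t0" by (auto simp: t0_def)
  have nn: "\<Phi> (1 / t0) \<ge> 0" using t0 by (intro bernstein_eq_nn_integral(2)[OF cb]) simp
  show ?thesis
  proof (rule that[OF _ t0(1)])
    show "C > 0" using nn t0 by (auto simp: C_def intro!: add_nonneg_pos)
    fix t assume t: "t0 \<le> t"
    have "\<Phi> (1 / t) \<le> \<Phi> (1 / t0) * (2 * t0) powr a * t powr (- a)"
    proof (rule power_bound_of_doubling[where g = "\<lambda>t. \<Phi> (1 / t)", OF t0(1) a(1) _ _ nn t])
      show "\<Phi> (1 / t) \<le> \<Phi> (1 / s)" if "t0 \<le> s" "s \<le> t" for s t
        using that t0 by (intro bernstein_mono[OF cb]) (auto simp: frac_le)
    qed (use t1 t0 in auto)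
    also have "\<dots> \<le> C * t powr (- a)" by (intro mult_right_mono) (auto simp: C_def)
    finally show "\<Phi> (1 / t) \<le> C * t powr (- a)" .
  qed
qed

section \<open>The nonlocal operator at a point\<close>

text \<open>
  The splitting at radius \<open>R\<close> in abstract form. For \<open>|h| \<ge> R\<close>, the shifted values of \<open>\<phi>\<close> are
  compared with a constant \<open>b\<close> plus a function \<open>\<psi>\<close> of finite mass \<open>S\<close>: the constant is
  integrated against the tail of \<open>j\<close>, whereas for \<open>\<psi>\<close> the supremum of \<open>j\<close> beyond \<open>R\<close> is taken out. At
  infinity \<open>\<psi>\<close> is \<open>\<phi>\<close> restricted to a ball about the origin; on compact sets \<open>\<psi> = 0\<close>.
  Integrability is part of the conclusion because the pointwise formula for the potential
  presupposes it.
\<close>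

lemma integral_second_diff_le:
  fixes \<phi> \<psi> :: "'a::euclidean_space \<Rightarrow> real"
  assumes meas: "\<phi> \<in> borel_measurable lebesgue" "\<psi> \<in> borel_measurable lebesgue"
      "j \<in> borel_measurable borel"
    and nonneg: "\<And>y. \<phi> y \<ge> 0" "\<And>y. \<psi> y \<ge> 0" "\<And>r. j r \<ge> 0" "b \<ge> 0" "L \<ge> 0" "q \<ge> 0" "S \<ge> 0"
    and R: "R > 0"
    and moment: "(\<integral>\<^sup>+h. ennreal (min (R\<^sup>2) ((norm (h::'a))\<^sup>2) * j (norm h)) \<partial>lborel) \<le> ennreal (R\<^sup>2 * q)"
    and tail: "\<And>r. R \<le> r \<Longrightarrow> j r \<le> q / R ^ DIM('a)"
    and near: "\<And>h. norm h < R \<Longrightarrow> \<bar>second_diff h \<phi> x\<bar> \<le> L * (norm h)\<^sup>2"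
    and far: "AE y in lebesgue. \<phi> y \<le> b + \<psi> y"
    and S: "(\<integral>\<^sup>+y. ennreal (\<psi> y) \<partial>lebesgue) \<le> ennreal S"
  shows "integrable lebesgue (\<lambda>h. second_diff h \<phi> x * j (norm h))"
    and "\<bar>LINT h|lebesgue. second_diff h \<phi> x * j (norm h)\<bar>
      \<le> q * (L * R\<^sup>2 + 2 * \<phi> x + 2 * b + 2 * S / R ^ DIM('a))"
proof -
  let ?F = "\<lambda>h. second_diff h \<phi> x * j (norm h)"
  note [measurable] = measurable_translates[OF meas(1), of x] measurable_translates[OF meas(2), of x]
  have jm [measurable]: "(\<lambda>h::'a. j (norm h)) \<in> borel_measurable lebesgue"
    by (rule measurable_completion) (use meas(3) in measurable)
  have Fm [measurable]: "?F \<in> borel_measurable lebesgue"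
    unfolding second_diff_def by measurable
  have nm [measurable]: "(\<lambda>h::'a. min (R\<^sup>2) ((norm h)\<^sup>2)) \<in> borel_measurable lebesgue"
    by (rule measurable_completion) measurable
  \<comment> \<open>Beyond \<open>R\<close> the truncated square is the constant \<open>R\<^sup>2\<close>, so the far constants are divided by it.\<close>
  define k where "k = L + (2 * \<phi> x + 2 * b) / R\<^sup>2"
  have k: "k \<ge> 0" using nonneg(1)[of x] nonneg by (auto simp: k_def)
  define w where "w = q / R ^ DIM('a)"
  have w: "w \<ge> 0" using nonneg R by (simp add: w_def)
  have "AE h in lebesgue. norm (?F h) \<le> k * (min (R\<^sup>2) ((norm h)\<^sup>2) * j (norm h)) + w * (\<psi> (x + h) + \<psi> (x - h))"
    using AE_lebesgue_affine[OF _ far, of 1 x] AE_lebesgue_affine[OF _ far, of "- 1" x]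
  proof simp_all
    assume "AE h in lebesgue. \<phi> (x + h) \<le> b + \<psi> (x + h)" "AE h in lebesgue. \<phi> (x - h) \<le> b + \<psi> (x - h)"
    then show "AE h in lebesgue. \<bar>?F h\<bar> \<le> k * (min (R\<^sup>2) ((norm h)\<^sup>2) * j (norm h)) + w * (\<psi> (x + h) + \<psi> (x - h))"
    proof eventually_elim
      case (elim h)
      let ?P = "\<psi> (x + h) + \<psi> (x - h)"
      have P: "?P \<ge> 0" using nonneg(2) by (simp add: add_nonneg_nonneg)
      show ?case
      proof (cases "norm h < R")
        case True
        then have "(norm h)\<^sup>2 \<le> R\<^sup>2" by (intro power_mono) auto
        then have m: "min (R\<^sup>2) ((norm h)\<^sup>2) = (norm h)\<^sup>2" by simp
        have "\<bar>second_diff h \<phi> x\<bar> \<le> k * (norm h)\<^sup>2"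
          using near[OF True] nonneg(1)[of x] nonneg(4) 
          by (elim order_trans) (auto simp: k_def intro!: mult_right_mono)
        then have "\<bar>second_diff h \<phi> x\<bar> * j (norm h) \<le> k * (norm h)\<^sup>2 * j (norm h)"
          by (rule mult_right_mono) (rule nonneg)
        moreover have "0 \<le> w * ?P" using w P by simp
        ultimately show ?thesis unfolding m using nonneg(3)[of "norm h"] by (simp add: abs_mult mult.assoc)
      next
        case False
        then have "R\<^sup>2 \<le> (norm h)\<^sup>2" using R by (intro power_mono) auto
        then have m: "min (R\<^sup>2) ((norm h)\<^sup>2) = R\<^sup>2" by simp
        have jw: "j (norm h) \<le> w" unfolding w_def using False by (intro tail) simp
        have "\<bar>second_diff h \<phi> x\<bar> \<le> \<phi> (x + h) + 2 * \<phi> x + \<phi> (x - h)"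
          unfolding second_diff_def using nonneg(1)[of x] nonneg(1)[of "x + h"] nonneg(1)[of "x - h"] by linarith
        also have "\<dots> \<le> (2 * \<phi> x + 2 * b) + ?P" using elim by simp
        finally have "\<bar>second_diff h \<phi> x\<bar> * j (norm h) \<le> ((2 * \<phi> x + 2 * b) + ?P) * j (norm h)"
          by (rule mult_right_mono) (rule nonneg)
        also have "\<dots> = (2 * \<phi> x + 2 * b) * j (norm h) + ?P * j (norm h)" by (simp add: distrib_right)
        also have "\<dots> \<le> (k * R\<^sup>2) * j (norm h) + ?P * w"
        proof (intro add_mono mult_mono mult_left_mono)
          show "2 * \<phi> x + 2 * b \<le> k * R\<^sup>2" using R nonneg(5) by (simp add: k_def field_simps)
        qed (use jw P k nonneg in auto)
        finally show ?thesis unfolding m using nonneg(3)[of "norm h"] by (simp add: abs_mult mult_ac)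
      qed
    qed
  qed
  then have "(\<integral>\<^sup>+h. ennreal (norm (?F h)) \<partial>lebesgue)
     \<le> (\<integral>\<^sup>+h. ennreal k * ennreal (min (R\<^sup>2) ((norm (h::'a))\<^sup>2) * j (norm h)) +
          ennreal w * (ennreal (\<psi> (x + h)) + ennreal (\<psi> (x - h))) \<partial>lebesgue)"
  proof (intro nn_integral_mono_AE, eventually_elim)
    case (elim h)
    then show ?case using k w nonneg
      by (simp add: ennreal_mult'[symmetric] ennreal_plus[symmetric] ennreal_leI del: ennreal_plus)
  qed
  also have "\<dots> = ennreal k * (\<integral>\<^sup>+h. ennreal (min (R\<^sup>2) ((norm (h::'a))\<^sup>2) * j (norm h)) \<partial>lebesgue) +
      ennreal w * ((\<integral>\<^sup>+h. ennreal (\<psi> (x + h)) \<partial>lebesgue) + (\<integral>\<^sup>+h. ennreal (\<psi> (x - h)) \<partial>lebesgue))"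
    by (simp add: nn_integral_add nn_integral_cmult)
  also have "\<dots> \<le> ennreal k * ennreal (R\<^sup>2 * q) + ennreal w * (ennreal S + ennreal S)"
    unfolding nn_integral_translates[OF meas(2)]
    using moment S by (intro add_mono mult_left_mono) (auto simp: nn_integral_completion)
  also have "\<dots> = ennreal (k * (R\<^sup>2 * q) + w * (S + S))"
    using k w nonneg by (simp add: ennreal_mult'[symmetric] ennreal_plus[symmetric] del: ennreal_plus)
  also have "k * (R\<^sup>2 * q) + w * (S + S) = q * (L * R\<^sup>2 + 2 * \<phi> x + 2 * b + 2 * S / R ^ DIM('a))"
    using R by (simp add: k_def w_def field_simps)
  finally have bound: "(\<integral>\<^sup>+h. ennreal (norm (?F h)) \<partial>lebesgue)
     \<le> ennreal (q * (L * R\<^sup>2 + 2 * \<phi> x + 2 * b + 2 * S / R ^ DIM('a)))" .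
  show int: "integrable lebesgue ?F"
    by (rule integrableI_bounded[OF Fm]) (rule le_less_trans[OF bound], simp)
  have "ennreal \<bar>LINT h|lebesgue. ?F h\<bar> \<le> (\<integral>\<^sup>+h. ennreal (norm (?F h)) \<partial>lebesgue)"
    using integral_norm_bound_ennreal[OF int] by simp
  also note bound
  finally show "\<bar>LINT h|lebesgue. ?F h\<bar> \<le> q * (L * R\<^sup>2 + 2 * \<phi> x + 2 * b + 2 * S / R ^ DIM('a))"
    using nonneg R nonneg(1)[of x] by (subst (asm) ennreal_le_iff) (auto intro!: mult_nonneg_nonneg add_nonneg_nonneg)
qed

lemma potential_pointwise_bound:
  fixes \<phi> \<psi> V :: "'a::euclidean_space \<Rightarrow> real"
  assumes cb: "complete_bernstein \<Phi> \<mu>" and V: "pointwise_potential \<mu> V \<phi>"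
    and pos: "\<And>y. \<phi> y > 0" and \<psi>: "\<And>y. \<psi> y \<ge> 0"
    and meas: "\<phi> \<in> borel_measurable lebesgue" "\<psi> \<in> borel_measurable lebesgue"
    and c: "c > 0"
    and moment: "(\<integral>\<^sup>+h. ennreal (min (R\<^sup>2) ((norm (h::'a))\<^sup>2) * jump_kernel DIM('a) \<mu> (norm h)) \<partial>lborel)
       \<le> ennreal (c * R\<^sup>2 * \<Phi> (1 / R\<^sup>2))"
    and tail: "\<And>r. R \<le> r \<Longrightarrow> jump_kernel DIM('a) \<mu> r \<le> c * \<Phi> (1 / R\<^sup>2) / R ^ DIM('a)"
    and R: "R > 0" and nonneg: "b \<ge> 0" "L \<ge> 0" "S \<ge> 0"
    and near: "\<And>h. norm h < R \<Longrightarrow> \<bar>second_diff h \<phi> x\<bar> \<le> L * (norm h)\<^sup>2"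
    and far: "AE y in lebesgue. \<phi> y \<le> b + \<psi> y"
    and S: "(\<integral>\<^sup>+y. ennreal (\<psi> y) \<partial>lebesgue) \<le> ennreal S"
  shows "\<bar>V x\<bar> \<le> c * \<Phi> (1 / R\<^sup>2) * (L * R\<^sup>2 + 2 * \<phi> x + 2 * b + 2 * S / R ^ DIM('a)) / (2 * \<phi> x)"
proof -
  have q: "c * \<Phi> (1 / R\<^sup>2) \<ge> 0"
    using c bernstein_eq_nn_integral(2)[OF cb, of "1 / R\<^sup>2"] by simp
  have m: "(\<integral>\<^sup>+h. ennreal (min (R\<^sup>2) ((norm (h::'a))\<^sup>2) * jump_kernel DIM('a) \<mu> (norm h)) \<partial>lborel)
       \<le> ennreal (R\<^sup>2 * (c * \<Phi> (1 / R\<^sup>2)))"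
    using moment by (simp only: mult_ac)
  note * = integral_second_diff_le[OF meas jump_kernel_measurable[OF cb] less_imp_le[OF pos] \<psi>
      jump_kernel_nonneg[OF cb] nonneg(1,2) q nonneg(3) R m tail near far S]
  let ?I = "LINT h|lebesgue. second_diff h \<phi> x * jump_kernel DIM('a) \<mu> (norm h)"
  have "V x = 1 / (2 * \<phi> x) * ?I"
    using V *(1) unfolding pointwise_potential_def by blast
  then have "\<bar>V x\<bar> = \<bar>?I\<bar> / (2 * \<phi> x)" using pos[of x] by (simp add: abs_mult)
  also have "\<dots> \<le> c * \<Phi> (1 / R\<^sup>2) * (L * R\<^sup>2 + 2 * \<phi> x + 2 * b + 2 * S / R ^ DIM('a)) / (2 * \<phi> x)"
    using *(2) pos[of x] by (intro divide_right_mono) auto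
  finally show ?thesis .
qed

section \<open>Decay of the potential at infinity\<close>

lemma Linfty_on_UNIV_E:
  assumes "\<phi> \<in> Linfty_on UNIV"
  obtains B where "\<phi> \<in> borel_measurable lebesgue" "B > 0" "AE y in lebesgue. \<bar>\<phi> y\<bar> \<le> B"
proof -
  obtain B where *: "\<phi> \<in> borel_measurable lebesgue" "AE y in lebesgue. \<bar>\<phi> y\<bar> \<le> B"
    using assms unfolding Linfty_on_def lebesgue_on_UNIV_eq by blast
  from *(2) have "AE y in lebesgue. \<bar>\<phi> y\<bar> \<le> max B 1" by eventually_elim simp
  with * that[of "max B 1"] show ?thesis by simp
qed

text \<open>
  On the ball of radius \<open>r\<close> the excess power of \<open>1 + |y|\<close> over the integrable weight
  \<open>(1 + |y|) powr (-d-\<delta>)\<close> is bounded by its value at the boundary. The loss \<open>\<delta>\<close> also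
  absorbs the logarithm that appears for \<open>2\<kappa> = d\<close>.
\<close>

lemma mass_growth:
  fixes \<phi> :: "'a::euclidean_space \<Rightarrow> real"
  assumes \<phi>: "\<phi> \<in> Linfty_on UNIV" and pos: "\<And>x. \<phi> x > 0"
    and M: "M > 0" and C: "C > 0" and \<kappa>: "\<kappa> > 0" and \<delta>: "\<delta> > 0"
    and upper: "\<And>x. norm x \<ge> M \<Longrightarrow> \<phi> x \<le> C * norm x powr (- 2 * \<kappa>)"
  obtains D where "D > 0" "\<And>r. r \<ge> 0 \<Longrightarrow>
     (\<integral>\<^sup>+y. ennreal (\<phi> y * indicator (ball 0 r) y) \<partial>lebesgue)
       \<le> ennreal (D * (1 + r) powr (max 0 (real DIM('a) + \<delta> - 2 * \<kappa>)))"
proof -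
  let ?d = "real DIM('a)"
  define m where "m = max 0 (?d + \<delta> - 2 * \<kappa>)"
  obtain B where meas: "\<phi> \<in> borel_measurable lebesgue" and B: "B > 0" "AE y in lebesgue. \<bar>\<phi> y\<bar> \<le> B"
    using Linfty_on_UNIV_E[OF \<phi>] by blast
  \<comment> \<open>The largest factor with \<open>\<theta> (1 + |y|) \<le> |y|\<close> for all \<open>|y| \<ge> M\<close>.\<close>
  define \<theta> where "\<theta> = M / (1 + M)"
  have \<theta>: "\<theta> > 0" using M by (simp add: \<theta>_def)
  define D0 where "D0 = B * (1 + M) powr (2 * \<kappa>) + C * \<theta> powr (- 2 * \<kappa>)"
  have D0: "D0 > 0" using B C M \<theta> by (auto simp: D0_def intro!: add_pos_pos)
  have dec: "AE y in lebesgue. \<phi> y \<le> D0 * (1 + norm y) powr (- 2 * \<kappa>)"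
    using B(2)
  proof eventually_elim
    case (elim y)
    show ?case
    proof (cases "norm y \<ge> M")
      case True
      have "\<theta> * (1 + norm y) \<le> norm y" using True M by (simp add: \<theta>_def field_simps)
      then have "norm y powr (- 2 * \<kappa>) \<le> (\<theta> * (1 + norm y)) powr (- 2 * \<kappa>)"
        using \<theta> \<kappa> by (intro powr_mono2') (auto intro!: mult_pos_pos add_pos_nonneg)
      also have "\<dots> = \<theta> powr (- 2 * \<kappa>) * (1 + norm y) powr (- 2 * \<kappa>)"
        using \<theta> by (intro powr_mult) 
      finally have "\<phi> y \<le> C * (\<theta> powr (- 2 * \<kappa>) * (1 + norm y) powr (- 2 * \<kappa>))"
        using upper[OF True] C by (meson mult_left_mono less_imp_le order_trans)
      also have "\<dots> \<le> D0 * (1 + norm y) powr (- 2 * \<kappa>)"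
        unfolding mult.assoc[symmetric] D0_def using B by (intro mult_right_mono) auto
      finally show ?thesis .
    next
      case False
      have "\<phi> y \<le> B * 1" using elim by simp
      also have "\<dots> \<le> B * ((1 + M) powr (2 * \<kappa>) * (1 + norm y) powr (- 2 * \<kappa>))"
      proof (intro mult_left_mono)
        have "(1 + M) powr (- 2 * \<kappa>) \<le> (1 + norm y) powr (- 2 * \<kappa>)"
          using False \<kappa> M by (intro powr_mono2') (auto intro: add_pos_nonneg)
        then have "(1 + M) powr (2 * \<kappa>) * (1 + M) powr (- 2 * \<kappa>) \<le> (1 + M) powr (2 * \<kappa>) * (1 + norm y) powr (- 2 * \<kappa>)"
          by (intro mult_left_mono) auto
        then show "1 \<le> (1 + M) powr (2 * \<kappa>) * (1 + norm y) powr (- 2 * \<kappa>)"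
          using M by (simp add: powr_add[symmetric])
      qed (use B in simp)
      also have "\<dots> \<le> D0 * (1 + norm y) powr (- 2 * \<kappa>)"
        unfolding mult.assoc[symmetric] D0_def using C by (intro mult_right_mono) auto
      finally show ?thesis .
    qed
  qed
  let ?w = "\<lambda>y::'a. (1 + norm y) powr (- (?d + \<delta>))"
  define W where "W = enn2real (\<integral>\<^sup>+y. ennreal (?w y) \<partial>lborel) + 1"
  have W: "W > 0" "(\<integral>\<^sup>+y. ennreal (?w y) \<partial>lborel) \<le> ennreal W"
    using nn_integral_inverse_power_finite[where 'a = 'a, of "?d + \<delta>"] \<delta>
    by (auto simp: W_def add_nonneg_pos less_top ennreal_plus)
  show ?thesis
  proof (rule that[of "D0 * W"])
    show "D0 * W > 0" using D0 W by simp
    fix r :: real assume r: "r \<ge> 0"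
    have "(\<integral>\<^sup>+y. ennreal (\<phi> y * indicator (ball 0 r) y) \<partial>lebesgue)
        \<le> (\<integral>\<^sup>+y. ennreal (D0 * (1 + r) powr m) * ennreal (?w y) \<partial>lebesgue)"
    proof (intro nn_integral_mono_AE, use dec in eventually_elim)
      case (elim y)
      show ?case
      proof (cases "norm y < r")
        case True
        have "(1 + norm y) powr (- 2 * \<kappa>) = (1 + norm y) powr (?d + \<delta> - 2 * \<kappa>) * ?w y"
          by (simp add: powr_add[symmetric])
        also have "\<dots> \<le> (1 + r) powr m * ?w y"
        proof (rule mult_right_mono)
          have "(1 + norm y) powr (?d + \<delta> - 2 * \<kappa>) \<le> (1 + norm y) powr m"
            by (intro powr_mono) (auto simp: m_def)
          also have "\<dots> \<le> (1 + r) powr m" using True by (intro powr_mono2) (auto simp: m_def)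
          finally show "(1 + norm y) powr (?d + \<delta> - 2 * \<kappa>) \<le> (1 + r) powr m" .
        qed simp
        finally have "D0 * (1 + norm y) powr (- 2 * \<kappa>) \<le> D0 * ((1 + r) powr m * ?w y)"
          using D0 by (intro mult_left_mono) auto
        with elim have "\<phi> y \<le> (D0 * (1 + r) powr m) * ?w y" by (simp add: mult.assoc)
        then show ?thesis using True D0 by (simp add: ennreal_mult'[symmetric] ennreal_leI)
      qed simp
    qed
    also have "\<dots> = (\<integral>\<^sup>+y. ennreal (D0 * (1 + r) powr m) * ennreal (?w y) \<partial>lborel)"
      by (rule nn_integral_completion)
    also have "\<dots> = ennreal (D0 * (1 + r) powr m) * (\<integral>\<^sup>+y. ennreal (?w y) \<partial>lborel)"
      by (rule nn_integral_cmult) measurable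
    also have "\<dots> \<le> ennreal (D0 * (1 + r) powr m) * ennreal W"
      by (intro mult_left_mono W) simp
    also have "\<dots> = ennreal (D0 * W * (1 + r) powr m)"
      using D0 W by (simp add: ennreal_mult'[symmetric] mult_ac)
    finally show "(\<integral>\<^sup>+y. ennreal (\<phi> y * indicator (ball 0 r) y) \<partial>lebesgue)
       \<le> ennreal (D0 * W * (1 + r) powr (max 0 (?d + \<delta> - 2 * \<kappa>)))" unfolding m_def .
  qed
qed

text \<open>
  One loss of \<open>\<delta>\<close> comes from \<open>bernstein_decay\<close> and the other from \<open>mass_growth\<close>.
\<close>

lemma potential_decay:
  fixes \<phi> V L\<^sub>\<phi> :: "'a::euclidean_space \<Rightarrow> real"
  assumes cb: "complete_bernstein \<Phi> \<mu>" and V: "pointwise_potential \<mu> V \<phi>"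
    and \<phi>: "\<phi> \<in> Linfty_on UNIV" and pos: "\<And>x. \<phi> x > 0"
    and C1: "0 < C\<^sub>1" and Z: "ZC_bound C\<^sub>1 \<phi> M\<^sub>\<phi> L\<^sub>\<phi>"
    and l: "slowly_varying_at_zero l"
    and asymp: "\<Phi> \<sim>[at_right 0] (\<lambda>u. u powr (\<alpha> / 2) * l u)"
    and C: "C\<^sub>2 > 0" "C\<^sub>3 > 0" "M\<^sub>1 > 0" and \<kappa>: "0 < \<kappa>"
    and lower: "\<And>x. norm x \<ge> M\<^sub>1 \<Longrightarrow> C\<^sub>2 * norm x powr (- 2 * \<kappa>) \<le> \<phi> x"
    and upper: "\<And>x. norm x \<ge> M\<^sub>1 \<Longrightarrow> \<phi> x \<le> C\<^sub>3 * norm x powr (- 2 * \<kappa>)"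
    and C4: "C\<^sub>4 > 0" and L\<^sub>\<phi>: "\<And>x. norm x \<ge> M\<^sub>2 \<Longrightarrow> L\<^sub>\<phi> x \<le> C\<^sub>4 * norm x powr (- (2 * \<kappa> + 2))"
    and \<delta>: "0 < \<delta>" "\<delta> \<le> \<alpha>"
  obtains M D where "M \<ge> 1" "D > 0"
    "\<And>x. norm x \<ge> M \<Longrightarrow> \<bar>V x\<bar> \<le> D * norm x powr (- (\<alpha> - max 0 (2 * \<kappa> - real DIM('a)) - 2 * \<delta>))"
proof -
  let ?d = "real DIM('a)"
  define m where "m = max 0 (?d + \<delta> - 2 * \<kappa>)"
  define n where "n = max 0 (2 * \<kappa> - ?d) + \<delta>"
  have mn: "m - ?d + 2 * \<kappa> \<le> n" "n \<ge> 0" "m \<ge> 0" using \<delta> by (auto simp: m_def n_def)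
  have meas: "\<phi> \<in> borel_measurable lebesgue" using Linfty_on_UNIV_E[OF \<phi>] by blast
  obtain c where c: "c > 0"
    and moment: "\<And>R. R > 0 \<Longrightarrow>
       (\<integral>\<^sup>+h. ennreal (min (R\<^sup>2) ((norm (h::'a))\<^sup>2) * jump_kernel DIM('a) \<mu> (norm h)) \<partial>lborel)
       \<le> ennreal (c * R\<^sup>2 * \<Phi> (1 / R\<^sup>2))"
    and tail: "\<And>R r. R > 0 \<Longrightarrow> R \<le> r \<Longrightarrow> jump_kernel DIM('a) \<mu> r \<le> c * \<Phi> (1 / R\<^sup>2) / R ^ DIM('a)"
    using jump_kernel_bounds[OF cb, where 'a = 'a] by blast
  obtain C' t0 where C': "C' > 0" "t0 > 0"
    and \<Phi>: "\<And>t. t0 \<le> t \<Longrightarrow> \<Phi> (1 / t) \<le> C' * t powr (- ((\<alpha> - \<delta>) / 2))"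
    using bernstein_decay[OF cb l asymp, of "(\<alpha> - \<delta>) / 2"] \<delta> by (auto simp: field_simps)
  obtain D1 where D1: "D1 > 0" and mass: "\<And>r. r \<ge> 0 \<Longrightarrow>
     (\<integral>\<^sup>+y. ennreal (\<phi> y * indicator (ball 0 r) y) \<partial>lebesgue) \<le> ennreal (D1 * (1 + r) powr m)"
    using mass_growth[OF \<phi> pos C(3,2) \<kappa> \<delta>(1) upper] unfolding m_def by blast
  \<comment> \<open>The last entry puts \<open>(C\<^sub>1 |x|)\<^sup>2\<close> into the range where \<open>\<Phi>\<close> is known to decay.\<close>
  define M where "M = Max {1, M\<^sub>1, M\<^sub>2, M\<^sub>\<phi>, sqrt t0 / C\<^sub>1}"
  have M: "1 \<le> M" "M\<^sub>1 \<le> M" "M\<^sub>2 \<le> M" "M\<^sub>\<phi> \<le> M" "sqrt t0 / C\<^sub>1 \<le> M" by (auto simp: M_def)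
  \<comment> \<open>The three summands belong to the near part, to the constants of the far part, and to the mass near the origin.\<close>
  define E where "E = C\<^sub>4 * C\<^sub>1\<^sup>2 + 4 * C\<^sub>3 + 2 * D1 * 2 powr m / C\<^sub>1 ^ DIM('a)"
  define D where "D = c * C' * C\<^sub>1 powr (- (\<alpha> - \<delta>)) * E / (2 * C\<^sub>2)"
  have E: "E > 0" using C C1 C4 D1 by (auto simp: E_def intro!: add_pos_nonneg)
  show ?thesis
  proof (rule that[OF M(1)])
    show "D > 0" using c C' C1 E C by (simp add: D_def)
    fix x :: 'a assume x: "norm x \<ge> M"
    define r where "r = norm x"
    define R where "R = C\<^sub>1 * r"
    define b where "b = C\<^sub>3 * r powr (- 2 * \<kappa>)"
    define L where "L = C\<^sub>4 * r powr (- (2 * \<kappa> + 2))"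
    define S where "S = D1 * (1 + r) powr m"
    have r: "r \<ge> 1" "r > 0" "r \<ge> M\<^sub>1" using x M by (auto simp: r_def)
    have R: "R > 0" using C1 r by (simp add: R_def)
    have bound: "\<bar>V x\<bar> \<le> c * \<Phi> (1 / R\<^sup>2) * (L * R\<^sup>2 + 2 * \<phi> x + 2 * b + 2 * S / R ^ DIM('a)) / (2 * \<phi> x)"
    proof (rule potential_pointwise_bound[OF cb V pos _ meas _ c moment[OF R] tail[OF R] R,
          where \<psi> = "\<lambda>y. \<phi> y * indicator (ball 0 r) y"])
      show "\<phi> y * indicator (ball 0 r) y \<ge> 0" for y using pos[of y] by simp
      show "(\<lambda>y. \<phi> y * indicator (ball 0 r) y) \<in> borel_measurable lebesgue"
        by (intro borel_measurable_times meas borel_measurable_indicator) simp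
      show "b \<ge> 0" "L \<ge> 0" "S \<ge> 0" using C C4 D1 r by (auto simp: b_def L_def S_def)
      show "(\<integral>\<^sup>+y. ennreal (\<phi> y * indicator (ball 0 r) y) \<partial>lebesgue) \<le> ennreal S"
        unfolding S_def using r by (intro mass) simp
      show "AE y in lebesgue. \<phi> y \<le> b + \<phi> y * indicator (ball 0 r) y"
      proof (rule AE_I2)
        fix y
        show "\<phi> y \<le> b + \<phi> y * indicator (ball 0 r) y"
        proof (cases "norm y < r")
          case True
          then show ?thesis using \<open>b \<ge> 0\<close> by simp
        next
          case False
          have "\<phi> y \<le> C\<^sub>3 * norm y powr (- 2 * \<kappa>)" using False r by (intro upper) simp
          also have "\<dots> \<le> b"
            unfolding b_def using False r \<kappa> C by (intro mult_left_mono powr_mono2') auto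
          finally show ?thesis using False by simp
        qed
      qed
      show "\<bar>second_diff h \<phi> x\<bar> \<le> L * (norm h)\<^sup>2" if "norm h < R" for h
      proof -
        have "\<bar>second_diff h \<phi> x\<bar> \<le> L\<^sub>\<phi> x * (norm h)\<^sup>2"
          using Z x M that unfolding ZC_bound_def R_def r_def by auto
        also have "\<dots> \<le> L * (norm h)\<^sup>2"
          unfolding L_def r_def using x M by (intro mult_right_mono L\<^sub>\<phi>) auto
        finally show ?thesis .
      qed
    qed
    have \<phi>l: "C\<^sub>2 * r powr (- 2 * \<kappa>) \<le> \<phi> x" and \<phi>u: "\<phi> x \<le> b"
      using lower[of x] upper[of x] r by (auto simp: r_def b_def)
    have "sqrt t0 / C\<^sub>1 \<le> r" using M(5) x by (simp add: r_def)
    then have "sqrt t0 \<le> R" using C1 by (simp add: R_def field_simps)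
    then have "t0 \<le> R\<^sup>2" using C' by (metis less_imp_le real_sqrt_le_iff real_sqrt_abs abs_of_pos R)
    then have "\<Phi> (1 / R\<^sup>2) \<le> C' * (R\<^sup>2) powr (- ((\<alpha> - \<delta>) / 2))" by (rule \<Phi>)
    also have "(R\<^sup>2) powr (- ((\<alpha> - \<delta>) / 2)) = R powr (- (\<alpha> - \<delta>))"
    proof -
      have "R\<^sup>2 = R powr 2" using R by simp
      moreover have "2 * (- ((\<alpha> - \<delta>) / 2)) = - (\<alpha> - \<delta>)" by (simp add: field_simps)
      ultimately show ?thesis by (simp only: powr_powr)
    qed
    also have "\<dots> = C\<^sub>1 powr (- (\<alpha> - \<delta>)) * r powr (- (\<alpha> - \<delta>))"
      unfolding R_def using C1 r by (simp add: powr_mult)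
    finally have \<Phi>R: "\<Phi> (1 / R\<^sup>2) \<le> C' * (C\<^sub>1 powr (- (\<alpha> - \<delta>)) * r powr (- (\<alpha> - \<delta>)))" .
    have "L * R\<^sup>2 + 2 * \<phi> x + 2 * b + 2 * S / R ^ DIM('a) \<le> E * r powr (n - 2 * \<kappa>)"
    proof -
      have e1: "r powr (- 2 * \<kappa>) \<le> r powr (n - 2 * \<kappa>)"
        using r mn by (intro powr_mono) auto
      have "L * R\<^sup>2 = C\<^sub>4 * C\<^sub>1\<^sup>2 * (r powr (- (2 * \<kappa> + 2)) * r powr 2)"
        using r by (simp add: L_def R_def power_mult_distrib)
      also have "r powr (- (2 * \<kappa> + 2)) * r powr 2 = r powr (- 2 * \<kappa>)"
        by (simp add: powr_add[symmetric])
      also have "C\<^sub>4 * C\<^sub>1\<^sup>2 * \<dots> \<le> C\<^sub>4 * C\<^sub>1\<^sup>2 * r powr (n - 2 * \<kappa>)"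
        using e1 C4 by (intro mult_left_mono) auto
      finally have t1: "L * R\<^sup>2 \<le> C\<^sub>4 * C\<^sub>1\<^sup>2 * r powr (n - 2 * \<kappa>)" .
      have "b \<le> C\<^sub>3 * r powr (n - 2 * \<kappa>)" unfolding b_def using e1 C by (intro mult_left_mono) auto
      then have t2: "2 * \<phi> x + 2 * b \<le> 4 * C\<^sub>3 * r powr (n - 2 * \<kappa>)" using \<phi>u by simp
      have "(1 + r) powr m \<le> (2 * r) powr m" using r mn by (intro powr_mono2) auto
      also have "\<dots> = 2 powr m * r powr m" using r by (simp add: powr_mult)
      finally have "S / R ^ DIM('a) \<le> D1 * (2 powr m * r powr m) / R ^ DIM('a)"
        unfolding S_def using D1 R by (intro divide_right_mono mult_left_mono) auto
      also have "\<dots> = D1 * 2 powr m / C\<^sub>1 ^ DIM('a) * (r powr m / r powr ?d)"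
        using r by (simp add: R_def power_mult_distrib powr_realpow)
      also have "r powr m / r powr ?d = r powr (m - ?d)" by (simp add: powr_diff)
      also have "D1 * 2 powr m / C\<^sub>1 ^ DIM('a) * r powr (m - ?d) \<le> D1 * 2 powr m / C\<^sub>1 ^ DIM('a) * r powr (n - 2 * \<kappa>)"
        using r mn D1 C1 by (intro mult_left_mono powr_mono) auto
      finally have t3: "2 * S / R ^ DIM('a) \<le> 2 * D1 * 2 powr m / C\<^sub>1 ^ DIM('a) * r powr (n - 2 * \<kappa>)"
        by simp
      show ?thesis using t1 t2 t3 unfolding E_def distrib_right by linarith
    qed
    note sum_bound = this
    have Q: "c * \<Phi> (1 / R\<^sup>2) \<ge> 0"
      using c bernstein_eq_nn_integral(2)[OF cb, of "1 / R\<^sup>2"] by simp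
    note bound
    also have "c * \<Phi> (1 / R\<^sup>2) * (L * R\<^sup>2 + 2 * \<phi> x + 2 * b + 2 * S / R ^ DIM('a)) / (2 * \<phi> x)
        \<le> c * (C' * (C\<^sub>1 powr (- (\<alpha> - \<delta>)) * r powr (- (\<alpha> - \<delta>)))) * (E * r powr (n - 2 * \<kappa>)) / (2 * (C\<^sub>2 * r powr (- 2 * \<kappa>)))"
    proof (intro frac_le mult_mono)
      show "\<Phi> (1 / R\<^sup>2) \<le> C' * (C\<^sub>1 powr (- (\<alpha> - \<delta>)) * r powr (- (\<alpha> - \<delta>)))" by (rule \<Phi>R)
    qed (use sum_bound \<phi>l c C C' r pos[of x] E bernstein_eq_nn_integral(2)[OF cb, of "1 / R\<^sup>2"] 
           C4 D1 R in \<open>auto simp: L_def b_def S_def intro!: add_nonneg_nonneg mult_nonneg_nonneg\<close>)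
    also have "\<dots> = D * (r powr (- (\<alpha> - \<delta>)) * r powr (n - 2 * \<kappa>) / r powr (- 2 * \<kappa>))"
      by (simp add: D_def mult_ac)
    also have "r powr (- (\<alpha> - \<delta>)) * r powr (n - 2 * \<kappa>) / r powr (- 2 * \<kappa>) = r powr (- (\<alpha> - \<delta>) + (n - 2 * \<kappa>) - (- 2 * \<kappa>))"
      by (simp only: powr_add powr_diff)
    also have "- (\<alpha> - \<delta>) + (n - 2 * \<kappa>) - (- 2 * \<kappa>) = - (\<alpha> - max 0 (2 * \<kappa> - ?d) - 2 * \<delta>)"
      by (simp add: n_def)
    finally show "\<bar>V x\<bar> \<le> D * norm x powr (- (\<alpha> - max 0 (2 * \<kappa> - ?d) - 2 * \<delta>))" by (simp only: r_def)
  qed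
qed

section \<open>Local boundedness of the potential\<close>

text \<open>
  Integrating the second difference at \<open>x\<close> against the even Lipschitz bump \<open>k r\<close> of radius \<open>r\<close> gives
  twice the difference between the average \<open>A r x\<close> of \<open>\<phi>\<close> around \<open>x\<close> and \<open>\<phi> x\<close>, multiplied by
  the mass of the bump. Hence the averages converge to \<open>\<phi>\<close> uniformly on \<open>K\<close>, at the rate \<open>r\<^sup>2\<close>;
  they are Lipschitz since \<open>k r\<close> is and \<open>\<phi>\<close> is essentially bounded.
\<close>

lemma Zb_imp_continuous_on:
  fixes \<phi> :: "'a::euclidean_space \<Rightarrow> real"
  assumes "\<phi> \<in> Zb K" and "bounded K"
  shows "continuous_on K \<phi>"
proof -
  obtain B where meas [measurable]: "\<phi> \<in> borel_measurable lebesgue" and B: "AE y in lebesgue. \<bar>\<phi> y\<bar> \<le> B"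
    using assms(1) unfolding Zb_def Linfty_on_def lebesgue_on_UNIV_eq by blast
  obtain R0 L where R0: "R0 > 0" and bL: "bounded (L ` K)"
    and D: "\<And>x h. x \<in> K \<Longrightarrow> norm h < R0 \<Longrightarrow> \<bar>second_diff h \<phi> x\<bar> \<le> L x * (norm h)\<^sup>2"
    using assms(1) by (auto simp: Zb_def)
  obtain N where N: "N > 0" "\<And>x. x \<in> K \<Longrightarrow> norm x \<le> N"
    using assms(2) by (auto simp: bounded_pos)
  obtain L0 where L0: "L0 > 0" "\<And>x. x \<in> K \<Longrightarrow> \<bar>L x\<bar> \<le> L0"
    using bL by (auto simp: bounded_pos)
  define B' where "B' = max B 0"
  have B': "B' \<ge> 0" "AE y in lebesgue. \<bar>\<phi> y\<bar> \<le> B'"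
    using B by (auto simp: B'_def)
  define k :: "real \<Rightarrow> 'a \<Rightarrow> real" where "k r h = max 0 (r - norm h)" for r h
  have kb [measurable]: "k r \<in> borel_measurable borel" for r unfolding k_def by measurable
  have km [measurable]: "k r \<in> borel_measurable lebesgue" for r
    by (rule measurable_completion) simp
  have k_le: "0 \<le> k r h" "k r h \<le> r * indicator (ball 0 r) h" if "r > 0" for r h
    using that by (auto simp: k_def indicator_def)
  have k_even: "k r (- h) = k r h" for r h by (simp add: k_def)
  have ind_int: "integrable lebesgue (\<lambda>h::'a. indicator (cball 0 r) h :: real)" for r
    using emeasure_bounded_finite[OF bounded_cball, of "0::'a" r] by (intro integrable_real_indicator) auto
  have k_int: "integrable lebesgue (k r)" if r: "r > 0" for r
    by (rule Bochner_Integration.integrable_bound[OF integrable_mult_right[OF ind_int[of r], of r] km])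
       (use r in \<open>auto simp: k_def indicator_def\<close>)
  define I where "I r = (LINT h|lebesgue. k r h)" for r
  have I_pos: "I r > 0" if r: "r > 0" for r
  proof -
    have "(LINT h|lebesgue. r / 2 * indicator (ball (0::'a) (r / 2)) h) \<le> I r"
      unfolding I_def
    proof (rule integral_mono[OF _ k_int[OF r]])
      show "integrable lebesgue (\<lambda>h::'a. r / 2 * indicator (ball 0 (r / 2)) h)"
        using emeasure_bounded_finite[OF bounded_ball, of "0::'a" "r / 2"]
        by (intro integrable_mult_right integrable_real_indicator) auto
      show "r / 2 * indicator (ball 0 (r / 2)) h \<le> k r h" for h :: 'a
        using r by (auto simp: k_def indicator_def)
    qed
    moreover have "(LINT h|lebesgue. r / 2 * indicator (ball (0::'a) (r / 2)) h) > 0"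
      using r content_ball_pos[of "r / 2" "0::'a"] by simp
    ultimately show ?thesis by linarith
  qed
  define A where "A r x = (LINT y|lebesgue. \<phi> y * k r (y - x)) / I r" for r x
  have kt [measurable]: "(\<lambda>y. k r (y - x)) \<in> borel_measurable lebesgue" for r x
    by (rule measurable_completion) simp
  have prod_int: "integrable lebesgue (\<lambda>y. \<phi> y * k r (y - x))" if r: "r > 0" for r x
  proof (rule Bochner_Integration.integrable_bound[OF integrable_mult_right[OF ind_int[of "norm x + r"], of "B' * r"]])
    show "AE y in lebesgue. norm (\<phi> y * k r (y - x)) \<le> norm (B' * r * indicator (cball 0 (norm x + r)) y)"
      using B'(2)
    proof eventually_elim
      case (elim y)
      show ?case
      proof (cases "norm y \<le> norm x + r")
        case True
        have "\<bar>\<phi> y\<bar> * \<bar>k r (y - x)\<bar> \<le> B' * r"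
          using elim r B' by (intro mult_mono) (auto simp: k_def)
        then show ?thesis using True r B' by (simp add: abs_mult)
      next
        case False
        then have "norm (y - x) > r" using norm_triangle_ineq2[of y x] by linarith
        then show ?thesis using False by (simp add: k_def)
      qed
    qed
  qed measurable
  have A_cont: "continuous_on K (A r)" if r: "r > 0" for r
  proof -
    define v where "v = measure lebesgue (cball (0::'a) (N + r))"
    have lip: "\<bar>A r x - A r z\<bar> \<le> B' * v / I r * norm (x - z)" if x: "x \<in> K" and z: "z \<in> K" for x z
    proof -
      have "(LINT y|lebesgue. \<phi> y * k r (y - x)) - (LINT y|lebesgue. \<phi> y * k r (y - z))
          = (LINT y|lebesgue. \<phi> y * k r (y - x) - \<phi> y * k r (y - z))"
        by (rule Bochner_Integration.integral_diff[symmetric]) (rule prod_int[OF r])+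
      also have "\<bar>\<dots>\<bar> \<le> (LINT y|lebesgue. \<bar>\<phi> y * k r (y - x) - \<phi> y * k r (y - z)\<bar>)"
        by (rule integral_abs_bound)
      also have "\<dots> \<le> (LINT y|lebesgue. (B' * norm (x - z)) * indicator (cball (0::'a) (N + r)) y)"
      proof (rule Bochner_Integration.integral_mono_AE)
        show "integrable lebesgue (\<lambda>y. B' * norm (x - z) * indicator (cball (0::'a) (N + r)) y)"
          by (intro integrable_mult_right ind_int)
        show "integrable lebesgue (\<lambda>y. \<bar>\<phi> y * k r (y - x) - \<phi> y * k r (y - z)\<bar>)"
          by (intro integrable_abs Bochner_Integration.integrable_diff prod_int r)
        show "AE y in lebesgue. \<bar>\<phi> y * k r (y - x) - \<phi> y * k r (y - z)\<bar>
            \<le> B' * norm (x - z) * indicator (cball 0 (N + r)) y"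
          using B'(2)
        proof eventually_elim
          case (elim y)
          show ?case
          proof (cases "norm y \<le> N + r")
            case True
            have "\<bar>k r (y - x) - k r (y - z)\<bar> \<le> \<bar>norm (y - x) - norm (y - z)\<bar>"
              unfolding k_def by linarith
            also have "\<dots> \<le> norm ((y - x) - (y - z))" by (rule norm_triangle_ineq3)
            also have "\<dots> = norm (x - z)" by (simp add: norm_minus_commute)
            finally have "\<bar>\<phi> y\<bar> * \<bar>k r (y - x) - k r (y - z)\<bar> \<le> B' * norm (x - z)"
              using elim B' by (intro mult_mono) auto
            then show ?thesis using True by (simp add: abs_mult[symmetric] right_diff_distrib)
          next
            case False
            then have "norm (y - x) > r" "norm (y - z) > r"
              using norm_triangle_ineq2[of y x] norm_triangle_ineq2[of y z] N(2)[OF x] N(2)[OF z] by linarith+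
            then show ?thesis using False by (simp add: k_def)
          qed
        qed
      qed
      also have "\<dots> = B' * norm (x - z) * v" by (simp add: v_def)
      finally show ?thesis
        using I_pos[OF r] by (simp add: A_def diff_divide_distrib[symmetric] field_simps)
    qed
    show ?thesis
    proof (rule lipschitz_on_continuous_on)
      show "(B' * v / I r)-lipschitz_on K (A r)"
        using lip I_pos[OF r] B' by (intro lipschitz_onI) (auto simp: dist_norm v_def)
    qed
  qed
  have A_near: "\<bar>A r x - \<phi> x\<bar> \<le> L0 * r\<^sup>2 / 2" if x: "x \<in> K" and r: "r > 0" "r < R0" for r x
  proof -
    let ?p = "\<lambda>h. \<phi> (x + h) * k r h" and ?m = "\<lambda>h. \<phi> (x - h) * k r h"
    have tm: "(\<lambda>y. \<phi> y * k r (y - x)) \<in> borel_measurable lebesgue" by measurable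
    have ip: "integrable lebesgue ?p" and im: "integrable lebesgue ?m"
      using integrable_translates[OF tm prod_int[OF r(1)], of x] by (simp_all add: k_even)
    have Ip: "(LINT h|lebesgue. ?p h) = A r x * I r" and Im: "(LINT h|lebesgue. ?m h) = A r x * I r"
      using integral_translates[OF tm, of x] I_pos[OF r(1)] by (simp_all add: A_def k_even)
    have "(LINT h|lebesgue. second_diff h \<phi> x * k r h)
        = (LINT h|lebesgue. (?p h - 2 * \<phi> x * k r h) + ?m h)"
      by (intro Bochner_Integration.integral_cong) (auto simp: second_diff_def algebra_simps)
    also have "\<dots> = (LINT h|lebesgue. ?p h) - 2 * \<phi> x * I r + (LINT h|lebesgue. ?m h)"
      unfolding I_def
      by (simp add: Bochner_Integration.integral_add Bochner_Integration.integral_diff ip im k_int[OF r(1)])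
    also have "\<dots> = 2 * I r * (A r x - \<phi> x)" unfolding Ip Im by (simp add: algebra_simps)
    finally have eq: "(LINT h|lebesgue. second_diff h \<phi> x * k r h) = 2 * I r * (A r x - \<phi> x)" .
    have int: "integrable lebesgue (\<lambda>h. second_diff h \<phi> x * k r h)"
    proof -
      have "integrable lebesgue (\<lambda>h. (?p h - 2 * \<phi> x * k r h) + ?m h)"
        by (intro Bochner_Integration.integrable_add Bochner_Integration.integrable_diff ip im integrable_mult_right k_int r)
      then show ?thesis by (simp add: second_diff_def algebra_simps)
    qed
    have "\<bar>LINT h|lebesgue. second_diff h \<phi> x * k r h\<bar> \<le> (LINT h|lebesgue. \<bar>second_diff h \<phi> x * k r h\<bar>)"
      by (rule integral_abs_bound)
    also have "\<dots> \<le> (LINT h|lebesgue. L0 * r\<^sup>2 * k r h)"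
    proof (rule Bochner_Integration.integral_mono)
      show "integrable lebesgue (\<lambda>h. \<bar>second_diff h \<phi> x * k r h\<bar>)" using int by (rule integrable_abs)
      show "integrable lebesgue (\<lambda>h. L0 * r\<^sup>2 * k r h)" by (intro integrable_mult_right k_int r)
      show "\<bar>second_diff h \<phi> x * k r h\<bar> \<le> L0 * r\<^sup>2 * k r h" for h
      proof (cases "norm h < r")
        case True
        have "\<bar>second_diff h \<phi> x\<bar> \<le> L x * (norm h)\<^sup>2" using True r by (intro D x) simp
        also have "\<dots> \<le> L0 * r\<^sup>2"
          using L0(2)[OF x] L0(1) True by (intro mult_mono power_mono) auto
        finally show ?thesis using k_le(1)[OF r(1), of h] by (simp add: abs_mult mult_right_mono)
      qed (use r in \<open>simp add: k_def\<close>)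
    qed
    also have "\<dots> = L0 * r\<^sup>2 * I r" by (simp add: I_def)
    finally have "2 * \<bar>A r x - \<phi> x\<bar> * I r \<le> L0 * r\<^sup>2 * I r"
      using I_pos[OF r(1)] unfolding eq abs_mult by (simp add: mult_ac)
    then show ?thesis using I_pos[OF r(1)] by simp
  qed
  have "uniform_limit K A \<phi> (at_right 0)"
  proof (rule uniform_limitI)
    fix e :: real assume e: "e > 0"
    \<comment> \<open>The bound \<open>r \<le> 1\<close> allows \<open>r\<^sup>2\<close> to be replaced by \<open>r\<close>.\<close>
    define \<delta> where "\<delta> = min (min 1 R0) (e / L0)"
    have "\<delta> > 0" using e R0 L0 by (simp add: \<delta>_def)
    from eventually_at_right_real[OF this]
    show "\<forall>\<^sub>F r in at_right 0. \<forall>x\<in>K. dist (A r x) (\<phi> x) < e"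
    proof eventually_elim
      case (elim r)
      then have r: "0 < r" "r < 1" "r < R0" "r * L0 < e" using L0 by (auto simp: \<delta>_def field_simps)
      have "L0 * r\<^sup>2 / 2 \<le> L0 * r" using r L0 by (simp add: power2_eq_square)
      then show ?case using A_near r by (force simp: dist_real_def mult.commute)
    qed
  qed
  then show ?thesis
    by (rule uniform_limit_theorem[rotated])
       (auto intro!: eventually_mono[OF eventually_at_right_less[of 0]] A_cont)
qed

text \<open>
  Since \<open>\<phi>\<close> is continuous and positive, it attains a positive minimum on \<open>K\<close>. The
  term \<open>2 * \<phi> x\<close> of the second difference contributes a constant after division by \<open>\<phi> x\<close>; the
  shifted values are estimated by the essential supremum of \<open>\<phi>\<close>.
\<close>

lemma potential_locally_bounded:
  fixes \<phi> V :: "'a::euclidean_space \<Rightarrow> real"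
  assumes cb: "complete_bernstein \<Phi> \<mu>" and V: "pointwise_potential \<mu> V \<phi>"
    and pos: "\<And>x. \<phi> x > 0" and K: "compact K" and Z: "\<phi> \<in> Zb K"
  obtains B where "\<And>x. x \<in> K \<Longrightarrow> \<bar>V x\<bar> \<le> B"
proof (cases "K = {}")
  case False
  have \<phi>: "\<phi> \<in> Linfty_on UNIV" using Z by (simp add: Zb_def)
  obtain B where meas: "\<phi> \<in> borel_measurable lebesgue" and B: "B > 0" "AE y in lebesgue. \<bar>\<phi> y\<bar> \<le> B"
    using Linfty_on_UNIV_E[OF \<phi>] by blast
  obtain R L where R: "R > 0" and bL: "bounded (L ` K)"
    and near: "\<And>x h. x \<in> K \<Longrightarrow> norm h < R \<Longrightarrow> \<bar>second_diff h \<phi> x\<bar> \<le> L x * (norm h)\<^sup>2"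
    using Z by (auto simp: Zb_def)
  obtain L0 where L0: "L0 > 0" "\<And>x. x \<in> K \<Longrightarrow> \<bar>L x\<bar> \<le> L0"
    using bL by (auto simp: bounded_pos)
  obtain c where c: "c > 0"
    and moment: "\<And>R. R > 0 \<Longrightarrow>
       (\<integral>\<^sup>+h. ennreal (min (R\<^sup>2) ((norm (h::'a))\<^sup>2) * jump_kernel DIM('a) \<mu> (norm h)) \<partial>lborel)
       \<le> ennreal (c * R\<^sup>2 * \<Phi> (1 / R\<^sup>2))"
    and tail: "\<And>R r. R > 0 \<Longrightarrow> R \<le> r \<Longrightarrow> jump_kernel DIM('a) \<mu> r \<le> c * \<Phi> (1 / R\<^sup>2) / R ^ DIM('a)"
    using jump_kernel_bounds[OF cb, where 'a = 'a] by blast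
  have cont: "continuous_on K \<phi>"
    using Z compact_imp_bounded[OF K] by (rule Zb_imp_continuous_on)
  obtain z where z: "z \<in> K" "\<And>x. x \<in> K \<Longrightarrow> \<phi> z \<le> \<phi> x"
    using continuous_attains_inf[OF K False cont] by blast
  define A where "A = c * \<Phi> (1 / R\<^sup>2)"
  have A: "A \<ge> 0"
    using c bernstein_eq_nn_integral(2)[OF cb, of "1 / R\<^sup>2"] by (simp add: A_def)
  show ?thesis
  proof (rule that)
    fix x assume x: "x \<in> K"
    have "\<bar>V x\<bar> \<le> c * \<Phi> (1 / R\<^sup>2) * (L0 * R\<^sup>2 + 2 * \<phi> x + 2 * B + 2 * 0 / R ^ DIM('a)) / (2 * \<phi> x)"
    proof (rule potential_pointwise_bound[OF cb V pos _ meas _ c moment[OF R] tail[OF R] R,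
          where \<psi> = "\<lambda>_. 0"])
      show "\<bar>second_diff h \<phi> x\<bar> \<le> L0 * (norm h)\<^sup>2" if "norm h < R" for h
      proof -
        have "\<bar>second_diff h \<phi> x\<bar> \<le> L x * (norm h)\<^sup>2" by (rule near[OF x that])
        also have "\<dots> \<le> L0 * (norm h)\<^sup>2" using L0(2)[OF x] by (intro mult_right_mono) auto
        finally show ?thesis .
      qed
      show "AE y in lebesgue. \<phi> y \<le> B + 0" using B(2) by eventually_elim simp
    qed (use B L0 in auto)
    also have "\<dots> = A * ((L0 * R\<^sup>2 + 2 * B) / (2 * \<phi> x) + 1)"
      using pos[of x] by (simp add: A_def field_simps)
    also have "\<dots> \<le> A * ((L0 * R\<^sup>2 + 2 * B) / (2 * \<phi> z) + 1)"
      using A pos[of x] pos[of z] z(2)[OF x] L0 B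
      by (intro mult_left_mono add_right_mono divide_left_mono) auto
    finally show "\<bar>V x\<bar> \<le> A * ((L0 * R\<^sup>2 + 2 * B) / (2 * \<phi> z) + 1)" .
  qed
qed (use that in auto)

section \<open>Integrability of the potential\<close>

text \<open>
  The pointwise formula says nothing where its integral diverges, so measurability is read off the
  equation, which determines \<open>V\<close> almost everywhere as \<open>- g / \<phi>\<close> with \<open>g\<close> in \<open>L\<^sup>2\<close>.
\<close>

lemma zero_energy_potential_measurable:
  fixes V \<phi> :: "'a::euclidean_space \<Rightarrow> real"
  assumes eq: "zero_energy_eq \<Phi> V \<phi>" and pos: "\<forall>x. \<phi> x > 0"
    and meas [measurable]: "\<phi> \<in> borel_measurable lebesgue"
  shows "V \<in> borel_measurable lebesgue"
proof -
  obtain g :: "'a \<Rightarrow> complex" where g: "g \<in> borel_measurable lebesgue"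
    and ae: "AE x in lebesgue. g x + complex_of_real (V x * \<phi> x) = 0"
    using eq unfolding zero_energy_eq_def Phi_Laplacian_def is_L2_fourier_def Lp_on_def lebesgue_on_UNIV_eq
    by blast
  note [measurable] = g
  have "(\<lambda>x. - Re (g x) / \<phi> x) \<in> borel_measurable lebesgue" by measurable
  moreover have "AE x in lebesgue. - Re (g x) / \<phi> x = V x"
    using ae
  proof eventually_elim
    case (elim x)
    then have "Re (g x) + V x * \<phi> x = 0" 
    proof -
      have "Re (g x + complex_of_real (V x * \<phi> x)) = 0" unfolding elim by simp
      then show ?thesis by (simp only: plus_complex.sel Re_complex_of_real)
    qed
    then show ?case using pos[rule_format, of x] by (simp add: field_simps)
  qed
  ultimately show ?thesis by (rule borel_measurable_AE)
qed

lemma Lp_on_of_decay: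
  fixes V :: "'a::euclidean_space \<Rightarrow> real"
  assumes meas [measurable]: "V \<in> borel_measurable lebesgue" and A [measurable]: "A \<in> sets lebesgue"
    and decay: "\<And>x. x \<in> A \<Longrightarrow> \<bar>V x\<bar> \<le> D * (1 + norm x) powr (- q)"
    and p: "p > 0" "p * q > real DIM('a)"
  shows "V \<in> Lp_on p A"
proof -
  have D: "D \<ge> 0" if "x \<in> A" for x
    using decay[OF that] abs_ge_zero[of "V x"] by (smt (verit) norm_ge_zero powr_gt_zero zero_le_mult_iff)
  have w: "integrable lebesgue (\<lambda>x::'a. (1 + norm x) powr (- (p * q)))"
  proof (rule integrableI_bounded)
    show "(\<lambda>x::'a. (1 + norm x) powr (- (p * q))) \<in> borel_measurable lebesgue"
      by (rule measurable_completion) measurable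
    show "(\<integral>\<^sup>+x. ennreal (norm ((1 + norm (x::'a)) powr (- (p * q)))) \<partial>lebesgue) < \<infinity>"
      using nn_integral_inverse_power_finite[OF p(2)] by (simp add: nn_integral_completion)
  qed
  have "integrable lebesgue (\<lambda>x. indicator A x *\<^sub>R norm (V x) powr p)"
  proof (rule Bochner_Integration.integrable_bound[OF integrable_mult_right[OF w, of "D powr p"]])
    show "AE x in lebesgue. norm (indicator A x *\<^sub>R norm (V x) powr p)
        \<le> norm (D powr p * (1 + norm x) powr (- (p * q)))"
    proof (rule AE_I2)
      fix x
      show "norm (indicator A x *\<^sub>R norm (V x) powr p) \<le> norm (D powr p * (1 + norm x) powr (- (p * q)))"
      proof (cases "x \<in> A")
        case True
        have "\<bar>V x\<bar> powr p \<le> (D * (1 + norm x) powr (- q)) powr p"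
          using decay[OF True] p by (intro powr_mono2) auto
        also have "\<dots> = D powr p * (1 + norm x) powr (- (p * q))"
          using D[OF True] by (simp add: powr_mult powr_powr mult.commute)
        finally show ?thesis using True by simp
      qed simp
    qed
  qed measurable
  then have "integrable (lebesgue_on A) (\<lambda>x. norm (V x) powr p)"
    using A by (subst integrable_restrict_space) auto
  moreover have "V \<in> borel_measurable (lebesgue_on A)"
    using meas by (rule measurable_restrict_space1)
  ultimately show ?thesis by (simp add: Lp_on_def)
qed

theorem theorem4p8:
  fixes \<Phi> \<mu> l :: "real \<Rightarrow> real"
    and \<phi> V L\<^sub>\<phi> :: "'a::euclidean_space \<Rightarrow> real"
    and C\<^sub>1 C\<^sub>2 C\<^sub>3 C\<^sub>4 M\<^sub>1 M\<^sub>2 M\<^sub>\<phi> \<alpha> \<kappa> :: real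
  assumes "complete_bernstein \<Phi> \<mu>"
    and "\<phi> \<in> Lp_on 2 UNIV \<inter> Linfty_on UNIV"
    and "\<forall>x. \<phi> x > 0"
    and "zero_energy_eq \<Phi> V \<phi>"
    and "pointwise_potential \<mu> V \<phi>"
    and "0 < C\<^sub>1" and "C\<^sub>1 < 1"
    and "\<phi> \<in> ZC C\<^sub>1" and "ZC_bound C\<^sub>1 \<phi> M\<^sub>\<phi> L\<^sub>\<phi>"
    and "0 < \<alpha>" and "\<alpha> < 2"
    and "slowly_varying_at_zero l"
    and "\<Phi> \<sim>[at_right 0] (\<lambda>u. u powr (\<alpha> / 2) * l u)"
    and "C\<^sub>2 > 0" and "C\<^sub>3 > 0" and "M\<^sub>1 > 0"
    and "0 < \<kappa>" and "\<kappa> < (real DIM('a) + \<alpha>) / 2"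
    and "\<forall>x \<in> - ball 0 M\<^sub>1. C\<^sub>2 * norm x powr (- 2 * \<kappa>) \<le> \<phi> x \<and>
                            \<phi> x \<le> C\<^sub>3 * norm x powr (- 2 * \<kappa>)"
    and "M\<^sub>2 > 0" and "C\<^sub>4 > 0"
    and "\<forall>x \<in> - ball 0 M\<^sub>2. L\<^sub>\<phi> x \<le> C\<^sub>4 * norm x powr (- (2 * \<kappa> + 2))"
  shows "(\<forall>p > p_star \<kappa> \<alpha> DIM('a). \<exists>M>0. V \<in> Lp_on p (- ball 0 M)) \<and>
         (\<phi> \<in> ZC C\<^sub>1 \<inter> Zb_loc \<longrightarrow>
            (\<forall>p > p_star \<kappa> \<alpha> DIM('a). V \<in> Lp_on p UNIV) \<and> V \<in> Linfty_loc)"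
proof -
  let ?d = "real DIM('a)"
  define \<beta> where "\<beta> = \<alpha> - max 0 (2 * \<kappa> - ?d)"
  have \<beta>: "\<beta> > 0" using assms(10,18) by (auto simp: \<beta>_def)
  have p_star: "p_star \<kappa> \<alpha> DIM('a) = ?d / \<beta>" by (auto simp: p_star_def \<beta>_def max_def)
  have Linf: "\<phi> \<in> Linfty_on UNIV" using assms(2) by blast
  have pos: "\<phi> x > 0" for x using assms(3) by blast
  have meas\<phi>: "\<phi> \<in> borel_measurable lebesgue" using Linfty_on_UNIV_E[OF Linf] by blast
  have meas: "V \<in> borel_measurable lebesgue"
    by (rule zero_energy_potential_measurable[OF assms(4,3) meas\<phi>])
  have lower: "C\<^sub>2 * norm x powr (- 2 * \<kappa>) \<le> \<phi> x" and upper: "\<phi> x \<le> C\<^sub>3 * norm x powr (- 2 * \<kappa>)"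
    if "norm x \<ge> M\<^sub>1" for x
    using assms(19) that by auto
  have L\<phi>: "L\<^sub>\<phi> x \<le> C\<^sub>4 * norm x powr (- (2 * \<kappa> + 2))" if "norm x \<ge> M\<^sub>2" for x
    using assms(22) that by auto
  have decay: "p > 0 \<and> (\<exists>q M D. q > 0 \<and> p * q > ?d \<and> M \<ge> 1 \<and> D > 0 \<and>
      (\<forall>x. norm x \<ge> M \<longrightarrow> \<bar>V x\<bar> \<le> D * (1 + norm x) powr (- q)))"
    if p: "p > p_star \<kappa> \<alpha> DIM('a)" for p
  proof -
    have pp: "p > 0" using p \<beta> unfolding p_star by (smt (verit) divide_nonneg_pos of_nat_0_le_iff)
    have "p * \<beta> > ?d" using p \<beta> unfolding p_star by (simp add: field_simps)
    then have gap: "\<beta> - ?d / p > 0" using pp by (simp add: field_simps)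
    \<comment> \<open>The decay rate is \<open>\<beta> - 2 \<delta>\<close>; a quarter of the gap between \<open>\<beta>\<close> and \<open>d / p\<close> keeps it above \<open>d / p\<close>.\<close>
    define \<delta> where "\<delta> = min \<alpha> ((\<beta> - ?d / p) / 4)"
    have \<delta>: "0 < \<delta>" "\<delta> \<le> \<alpha>" "\<delta> \<le> (\<beta> - ?d / p) / 4"
      unfolding \<delta>_def using gap assms(10) by (simp_all only: min_less_iff_conj min.cobounded1 min.cobounded2) simp
    define q where "q = \<beta> - 2 * \<delta>"
    have "?d / p < q" using \<delta> gap by (simp add: q_def)
    then have pq: "p * q > ?d" using pp by (simp add: field_simps)
    have q: "q > 0" using \<open>?d / p < q\<close> pp by (smt (verit) divide_nonneg_pos of_nat_0_le_iff)
    obtain M D where M: "M \<ge> 1" and D: "D > 0"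
      and V: "\<And>x. norm x \<ge> M \<Longrightarrow> \<bar>V x\<bar> \<le> D * norm x powr (- (\<alpha> - max 0 (2 * \<kappa> - ?d) - 2 * \<delta>))"
      using potential_decay[OF assms(1,5) Linf pos assms(6,9,12,13,14,15,16,17) lower upper assms(21) L\<phi> \<delta>(1,2)]
      by blast
    have "\<bar>V x\<bar> \<le> D * 2 powr q * (1 + norm x) powr (- q)" if x: "norm x \<ge> M" for x
    proof -
      have "\<bar>V x\<bar> \<le> D * norm x powr (- q)" using V[OF x] by (simp add: q_def \<beta>_def)
      also have "\<dots> \<le> D * ((1 + norm x) / 2) powr (- q)"
        using D q x M by (intro mult_left_mono powr_mono2') auto
      also have "\<dots> = D * 2 powr q * (1 + norm x) powr (- q)"
        by (simp add: powr_divide powr_minus field_simps)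
      finally show ?thesis .
    qed
    then show ?thesis using pp q pq M D
      by (intro conjI exI[of _ q] exI[of _ M] exI[of _ "D * 2 powr q"]) auto
  qed
  have part1: "\<exists>M>0. V \<in> Lp_on p (- ball 0 M)" if p: "p > p_star \<kappa> \<alpha> DIM('a)" for p
  proof -
    obtain q M D where "p > 0" "p * q > ?d" "M \<ge> 1"
      and "\<And>x. norm x \<ge> M \<Longrightarrow> \<bar>V x\<bar> \<le> D * (1 + norm x) powr (- q)"
      using decay[OF p] by blast
    then have "V \<in> Lp_on p (- ball 0 M)"
      by (intro Lp_on_of_decay[OF meas, where D = D and q = q]) auto
    then show ?thesis using \<open>M \<ge> 1\<close> by (intro exI[of _ M]) auto
  qed
  have part2: "V \<in> Lp_on p UNIV" if Zb: "\<phi> \<in> Zb_loc" and p: "p > p_star \<kappa> \<alpha> DIM('a)" for p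
  proof -
    obtain q M D where *: "p > 0" "q > 0" "p * q > ?d" "M \<ge> 1" "D > 0"
      and V: "\<And>x. norm x \<ge> M \<Longrightarrow> \<bar>V x\<bar> \<le> D * (1 + norm x) powr (- q)"
      using decay[OF p] by blast
    have "\<phi> \<in> Zb (cball 0 M)" using Zb by (simp add: Zb_loc_def)
    then obtain B where B: "\<And>x. x \<in> cball 0 M \<Longrightarrow> \<bar>V x\<bar> \<le> B"
      using potential_locally_bounded[OF assms(1,5) pos compact_cball] by blast
    define D' where "D' = D + \<bar>B\<bar> * (1 + M) powr q"
    have "\<bar>V x\<bar> \<le> D' * (1 + norm x) powr (- q)" for x
    proof (cases "norm x \<ge> M")
      case True
      have "D * (1 + norm x) powr (- q) \<le> D' * (1 + norm x) powr (- q)"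
        by (intro mult_right_mono) (auto simp: D'_def)
      then show ?thesis using V[OF True] by linarith
    next
      case False
      have "\<bar>V x\<bar> \<le> \<bar>B\<bar> * 1" using B[of x] False by simp
      also have "\<dots> = \<bar>B\<bar> * ((1 + M) powr q * (1 + M) powr (- q))"
        using * by (simp add: powr_add[symmetric])
      also have "\<dots> \<le> \<bar>B\<bar> * ((1 + M) powr q * (1 + norm x) powr (- q))"
        using False * by (intro mult_left_mono powr_mono2') (auto intro: add_pos_nonneg)
      also have "\<dots> \<le> D' * (1 + norm x) powr (- q)"
        unfolding mult.assoc[symmetric] D'_def using * by (intro mult_right_mono) auto
      finally show ?thesis .
    qed
    then show ?thesis using * by (intro Lp_on_of_decay[OF meas, where D = D' and q = q]) auto
  qed
  have part3: "V \<in> Linfty_loc" if Zb: "\<phi> \<in> Zb_loc"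
    unfolding Linfty_loc_def Linfty_on_def
  proof (safe intro!: measurable_restrict_space1 meas)
    fix K :: "'a set" assume K: "compact K"
    then have "\<phi> \<in> Zb K" using Zb by (simp add: Zb_loc_def)
    then obtain B where B: "\<And>x. x \<in> K \<Longrightarrow> \<bar>V x\<bar> \<le> B"
      using potential_locally_bounded[OF assms(1,5) pos K] by blast
    show "\<exists>B. AE x in lebesgue_on K. \<bar>V x\<bar> \<le> B"
      by (intro exI[of _ B] AE_I2 B) simp
  qed
  show ?thesis using part1 part2 part3 by blast
qed

end
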